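(* Let $s\in(\sqrt{3}-1,1)$ and choose $b$ such that $$\frac{1-s}{s}<b<\frac{s}{2}$$ (this is possible since $s>\sqrt3-1$). Let $(l_k)_{k=1}^\infty$ be a strictly increasing sequence of natural numbers and let $m_k=\lceil b\,l_k\rceil$. Define the compact sets $$A_k=\overline{\{x\in[0,1] : x_{l_k+1}\ldots x_{l_k+m_k}\neq 0^{m_k}\}},$$ where $x=0.x_1x_2\ldots$ is the binary expansion of $x$, and let $$B_n=\bigcap_{k=n}^\infty A_k,\qquad C=[0,1]\setminus\bigcup_{n=1}^\infty B_n=\bigcap_{n=1}^\infty\bigcup_{k=n}^\infty\big([0,1]\setminus A_k\big).$$ Then $\dim_{\mathrm F}B_n\le s$ for all $n$, and consequently $$\dim_{\mathrm{FC}}\Big(\bigcup_{n=1}^\infty B_n\Big)\le s.$$ Moreover, $\mathcal{H}^s_\delta(C)=0$ for all $\delta>0$, and thus $$\dim_{\mathrm{FC}}C\le\dim_{\mathrm H}C\le s.$$ Hence $[0,1]$ is the union of two sets with compact Fourier dimension strictly less than $1$, so the compact Fourier dimension is not finitely stable.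
   Context: For a finite Borel measure $\mu$ on $\mathbb{R}^d$ (here $d=1$), $\widehat\mu(\xi)=\int e^{-2\pi i \xi\cdot x}\,d\mu(x)$. The notation $f(\xi)\lesssim g(\xi)$ means there is a constant $M$ with $|f(\xi)|\le M|g(\xi)|$ for all $\xi$ (negative powers of $|\xi|$ are read as $+\infty$ at $\xi=0$). For a Borel set $A\subset\mathbb{R}^d$, $\mathcal{P}(A)$ is the set of Borel probability measures on $\mathbb{R}^d$ that give full measure to $A$. The Fourier dimension of $A$ is $\dim_{\mathrm{F}}A=\sup\{t\in[0,d]:\ \widehat\mu(\xi)\lesssim|\xi|^{-t/2} \text{ for some } \mu\in\mathcal{P}(A)\}$. The compact Fourier dimension of $A$ is $\dim_{\mathrm{FC}}A=\sup\{t\in[0,d]:\ \widehat\mu(\xi)\lesssim|\xi|^{-t/2}\text{ for some }\mu\in\mathcal{P}(K)\text{ with }K\subset A\text{ compact}\}$. $\dim_{\mathrm H}$ is Hausdorff dimension, and $\mathcal{H}^s_\delta(A)$ is the infimum of $\sum_i(\operatorname{diam}U_i)^s$ over countable covers $\{U_i\}$ of $A$ by sets of diameter at most $\delta$. The bar denotes topological closure, and $0^m$ denotes the string of $m$ zeros. Finite stability of a dimension $\dim$ means $\dim(\bigcup_k A_k)=\sup_k\dim A_k$ for all finite families of Borel sets. *)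

theory Defs
  imports "HOL-Probability.Probability"
begin

text \<open>
  All dimensions take values in \<^typ>\<open>ennreal\<close>, so that the supremum of the empty set of
  exponents (the dimension of the empty set) is 0.
\<close>

definition fourier_transform :: "'a::euclidean_space measure \<Rightarrow> 'a \<Rightarrow> complex" where
  "fourier_transform \<mu> \<xi> =
     (LINT x|\<mu>. exp (- 2 * complex_of_real pi * \<i> * complex_of_real (\<xi> \<bullet> x)))"

text \<open>
  At \<open>\<xi> = 0\<close> the bound is void: for \<open>t > 0\<close> because the right-hand side is read as
  infinity there, and for \<open>t = 0\<close> because a single value only enlarges the constant.
  The point is left out because \<open>0 powr a = 0\<close> in HOL.
\<close>

definition fourier_decay :: "'a::euclidean_space measure \<Rightarrow> real \<Rightarrow> bool" where
  "fourier_decay \<mu> t \<longleftrightarrow>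
     (\<exists>M::real. \<forall>\<xi>. \<xi> \<noteq> 0 \<longrightarrow> norm (fourier_transform \<mu> \<xi>) \<le> M * norm \<xi> powr (- t / 2))"

definition borel_probs :: "'a::euclidean_space set \<Rightarrow> 'a measure set" where
  "borel_probs A = {\<mu>. prob_space \<mu> \<and> sets \<mu> = sets borel \<and> emeasure \<mu> A = 1}"

definition fourier_dim :: "'a::euclidean_space set \<Rightarrow> ennreal" where
  "fourier_dim A =
     (SUP t \<in> {t \<in> {0..real DIM('a)}. \<exists>\<mu> \<in> borel_probs A. fourier_decay \<mu> t}. ennreal t)"

definition compact_fourier_dim :: "'a::euclidean_space set \<Rightarrow> ennreal" where
  "compact_fourier_dim A =
     (SUP t \<in> {t \<in> {0..real DIM('a)}.
                 \<exists>K. compact K \<and> K \<subseteq> A \<and> (\<exists>\<mu> \<in> borel_probs K. fourier_decay \<mu> t)}. ennreal t)"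

text \<open>
  The power \<open>(diam U)\<^sup>s\<close> with the conventions of geometric measure theory: the empty set
  contributes 0, and \<open>0\<^sup>0 = 1\<close> (whereas \<open>0 powr 0 = 0\<close> in HOL).
\<close>

definition diam_power :: "real \<Rightarrow> 'a::metric_space set \<Rightarrow> ennreal" where
  "diam_power s U =
     (if U = {} then 0 else if s = 0 then 1 else ennreal (diameter U powr s))"

text \<open>
  Covers are indexed by \<^typ>\<open>nat\<close>; finite covers are padded with empty sets.
  Boundedness is explicit because \<^const>\<open>diameter\<close> has no meaningful value on unbounded sets.
\<close>

definition hausdorff_content :: "real \<Rightarrow> real \<Rightarrow> 'a::metric_space set \<Rightarrow> ennreal" where
  "hausdorff_content s \<delta> A =
     (INF U \<in> {U :: nat \<Rightarrow> 'a set. (\<forall>i. bounded (U i) \<and> diameter (U i) \<le> \<delta>) \<and> A \<subseteq> (\<Union>i. U i)}.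
        (\<Sum>i. diam_power s (U i)))"

definition hausdorff_measure :: "real \<Rightarrow> 'a::metric_space set \<Rightarrow> ennreal" where
  "hausdorff_measure s A = (SUP \<delta> \<in> {0<..}. hausdorff_content s \<delta> A)"

definition hausdorff_dim :: "'a::metric_space set \<Rightarrow> ennreal" where
  "hausdorff_dim A = (INF s \<in> {s. 0 \<le> s \<and> hausdorff_measure s A = 0}. ennreal s)"

definition finitely_stable :: "('a::topological_space set \<Rightarrow> ennreal) \<Rightarrow> bool" where
  "finitely_stable D \<longleftrightarrow>
     (\<forall>(N::nat) A. N \<ge> 1 \<and> (\<forall>k\<in>{1..N}. A k \<in> sets borel) \<longrightarrow>
        D (\<Union>k\<in>{1..N}. A k) = (SUP k\<in>{1..N}. D (A k)))"

text \<open>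
  The \<open>j\<close>-th binary digit (\<open>j \<ge> 1\<close>) of \<open>x \<in> [0,1]\<close>.  Dyadic rationals in \<open>[0,1)\<close> get the
  terminating expansion and \<open>1 = 0.111\<dots>\<close>.  The choice is immaterial below, since the
  digits are only used inside a closure.
\<close>

definition bin_digit :: "real \<Rightarrow> nat \<Rightarrow> int" where
  "bin_digit x j = (if x = 1 then 1 else \<lfloor>2 ^ j * x\<rfloor> mod 2)"

definition m_seq :: "real \<Rightarrow> (nat \<Rightarrow> nat) \<Rightarrow> nat \<Rightarrow> nat" where
  "m_seq b l k = nat \<lceil>b * real (l k)\<rceil>"

definition A_set :: "real \<Rightarrow> (nat \<Rightarrow> nat) \<Rightarrow> nat \<Rightarrow> real set" where
  "A_set b l k =
     closure {x \<in> {0..1}.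
       map (bin_digit x) [l k + 1 ..< l k + m_seq b l k + 1] \<noteq> replicate (m_seq b l k) 0}"

definition B_set :: "real \<Rightarrow> (nat \<Rightarrow> nat) \<Rightarrow> nat \<Rightarrow> real set" where
  "B_set b l n = (\<Inter>k\<in>{n..}. A_set b l k)"

definition C_set :: "real \<Rightarrow> (nat \<Rightarrow> nat) \<Rightarrow> real set" where
  "C_set b l = {0..1} - (\<Union>n\<in>{1..}. B_set b l n)"

end

theory Submission
  imports Defs
begin

text \<open>
  The complement of \<open>A\<^sub>k\<close> in \<open>[0,1]\<close> lies in the set where \<open>2 ^ l\<^sub>k * x\<close> lies, modulo 1, in
  an arc of length \<open>2 ^ (- m\<^sub>k)\<close>. Integrating against \<open>\<mu>\<close> a trigonometric polynomial in
  \<open>2 ^ l\<^sub>k * x\<close> involves, besides its mean, only values of the Fourier transform at frequencies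
  of size at least \<open>2 ^ l\<^sub>k\<close>. If \<open>\<mu>\<close> has decay exponent \<open>t > 2 * b\<close>, a polynomial that is
  nonpositive off the arc but has large mean shows that \<open>\<mu>\<close> charges the gaps near every point of
  its support; this excludes compact sets inside \<open>\<Union>n. B\<^sub>n\<close>. For any \<open>t > 0\<close>, a majorant of the
  indicator of the arc shows that the masses of the gaps are summable, so that \<open>\<mu>\<close> gives no mass to
  \<open>C\<close> by the Borel-Cantelli lemma and the compact Fourier dimension of \<open>C\<close> is 0.
  Covering \<open>C\<close> by the dyadic gaps bounds its Hausdorff content, since \<open>s * (1 + b) > 1\<close>.
\<close>

section \<open>Trigonometric polynomials\<close>

lemma half_one_plus_cos_bounds:
  fixes \<theta> :: real
  shows "0 \<le> (1 + cos \<theta>) / 2" "(1 + cos \<theta>) / 2 \<le> 1"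
proof -
  have "0 \<le> 1 + cos \<theta>" using cos_ge_minus_one[of \<theta>] by linarith
  then show "0 \<le> (1 + cos \<theta>) / 2" by simp
qed simp

lemma abs_half_one_plus_cos_power_le:
  fixes \<theta> :: real
  shows "\<bar>((1 + cos \<theta>) / 2) ^ n\<bar> \<le> 1"
  unfolding power_abs abs_of_nonneg[OF half_one_plus_cos_bounds(1)]
  by (intro power_le_one half_one_plus_cos_bounds)

text \<open>Since \<open>1 + cos \<theta> = cis (- \<theta>) * (1 + cis \<theta>)\<^sup>2 /
  2\<close>, the binomial theorem with exponent \<open>2 * n\<close> gives the Fourier expansion
  after taking real parts. All coefficients are nonnegative, and the constant one is the central
  binomial coefficient over \<open>2 ^ n\<close>.\<close>

lemma one_plus_cos_power:
  fixes \<theta> :: real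
  shows "(1 + cos \<theta>) ^ n =
    (\<Sum>k\<le>2*n. real (2*n choose k) * cos ((real k - real n) * \<theta>)) / 2 ^ n"
proof -
  have base: "complex_of_real (1 + cos \<theta>) = cis (- \<theta>) * (1 + cis \<theta>)\<^sup>2 / 2"
  proof -
    have "cis (- \<theta>) * (1 + cis \<theta>)\<^sup>2 = cis (-\<theta>) + 2 * (cis (-\<theta>) * cis \<theta>) + (cis (-\<theta>) * cis \<theta>) * cis \<theta>"
      by (simp add: power2_eq_square algebra_simps)
    also have "cis (-\<theta>) * cis \<theta> = 1" by (simp add: cis_mult)
    finally show ?thesis by (simp add: complex_eq_iff)
  qed
  have cis_k: "cis (-\<theta>) ^ n * cis \<theta> ^ k = cis ((real k - real n) * \<theta>)" for k
    unfolding Complex.DeMoivre cis_mult by (rule arg_cong[where f = cis]) (simp add: algebra_simps)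
  have "complex_of_real ((1 + cos \<theta>) ^ n) = (cis (-\<theta>) * (1 + cis \<theta>)\<^sup>2 / 2) ^ n"
    by (simp only: of_real_power base)
  also have "\<dots> = cis (-\<theta>) ^ n * (cis \<theta> + 1) ^ (2 * n) / 2 ^ n"
    by (simp add: power_mult_distrib power_divide power_mult add.commute)
  also have "\<dots> = (\<Sum>k\<le>2*n. of_nat (2*n choose k) * (cis (-\<theta>) ^ n * cis \<theta> ^ k)) / 2 ^ n"
    by (simp add: binomial_ring sum_distrib_left mult_ac)
  also have "\<dots> = (\<Sum>k\<le>2*n. of_nat (2*n choose k) * cis ((real k - real n) * \<theta>)) / 2 ^ n"
    by (simp only: cis_k)
  finally have "Re (complex_of_real ((1 + cos \<theta>) ^ n)) =
      Re ((\<Sum>k\<le>2*n. of_nat (2*n choose k) * cis ((real k - real n) * \<theta>)) / 2 ^ n)"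
    by (rule arg_cong)
  moreover have "Re (z / 2 ^ n) = Re z / 2 ^ n" for z
    by (metis Re_divide_of_real of_real_numeral of_real_power)
  ultimately show ?thesis by simp
qed

lemma has_real_derivative_cos_sum:
  fixes a j :: "'a \<Rightarrow> real"
  shows "((\<lambda>\<theta>. (\<Sum>k\<in>I. a k * cos (j k * \<theta>)) / c) has_real_derivative
    - ((\<Sum>k\<in>I. a k * j k * sin (j k * \<theta>)) / c)) (at \<theta>)"
  by (auto intro!: derivative_eq_intros sum.cong
      simp: divide_inverse sum_distrib_left sum_distrib_right sum_negf[symmetric] mult_ac)

lemma has_real_derivative_sin_sum:
  fixes a j :: "'a \<Rightarrow> real"
  shows "((\<lambda>\<theta>. (\<Sum>k\<in>I. a k * sin (j k * \<theta>)) / c) has_real_derivative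
    (\<Sum>k\<in>I. a k * j k * cos (j k * \<theta>)) / c) (at \<theta>)"
  by (auto intro!: derivative_eq_intros sum.cong
      simp: divide_inverse sum_distrib_left sum_distrib_right mult_ac)

text \<open>
  Up to the factor \<open>- (n + 1)\<close>, the left-hand side is the second derivative of
  \<open>(1 + cos \<theta>) ^ (n + 1)\<close>: hence it has mean zero, and since its Fourier coefficients
  are nonnegative, their sum is its value at 0.
\<close>

lemma one_plus_cos_power_deriv2:
  fixes \<theta> :: real
  shows "(1 + cos \<theta>) ^ n * (1 - (real n + 1) * (1 - cos \<theta>)) =
    (\<Sum>k\<le>2*Suc n. real (2*Suc n choose k) * (real k - real (Suc n))\<^sup>2 *
        cos ((real k - real (Suc n)) * \<theta>)) / ((real n + 1) * 2 ^ Suc n)"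
proof -
  let ?c = "\<lambda>k. real (2*Suc n choose k)" and ?j = "\<lambda>k. real k - real (Suc n)"
  let ?I = "{..2*Suc n}"
  have d1: "((\<lambda>\<theta>. (1 + cos \<theta>) ^ Suc n) has_real_derivative
      - ((real n + 1) * (1 + cos \<theta>) ^ n * sin \<theta>)) (at \<theta>)" for \<theta>
    using DERIV_power_Suc[of "\<lambda>\<theta>. 1 + cos \<theta>" "- sin \<theta>" \<theta> UNIV n]
    by (auto intro!: derivative_eq_intros simp: mult_ac add.commute simp del: power_Suc)
  have d2: "((\<lambda>\<theta>. (\<Sum>k\<in>?I. ?c k * cos (?j k * \<theta>)) / 2 ^ Suc n) has_real_derivative
      - ((\<Sum>k\<in>?I. ?c k * ?j k * sin (?j k * \<theta>)) / 2 ^ Suc n)) (at \<theta>)" for \<theta>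
    by (rule has_real_derivative_cos_sum)
  \<comment> \<open>Both sides are minus the derivative of the same function, so uniqueness of
    derivatives yields the expansion. The second derivative is treated the same way.\<close>
  have first: "(real n + 1) * (1 + cos \<theta>) ^ n * sin \<theta> =
      (\<Sum>k\<in>?I. ?c k * ?j k * sin (?j k * \<theta>)) / 2 ^ Suc n" for \<theta>
    using DERIV_unique[OF d1 d2[folded one_plus_cos_power]] by simp
  have d3: "((\<lambda>\<theta>. (real n + 1) * (1 + cos \<theta>) ^ n * sin \<theta>) has_real_derivative
      (real n + 1) * ((1 + cos \<theta>) ^ n * (1 - (real n + 1) * (1 - cos \<theta>)))) (at \<theta>)"
  proof (cases n)
    case 0
    then show ?thesis by (auto intro!: derivative_eq_intros)
  next
    case (Suc m)
    \<comment> \<open>This factorization supplies the factor \<open>1 + cos \<theta>\<close> that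
      the power \<open>m = n - 1\<close> lacks.\<close>
    have s: "sin \<theta> * sin \<theta> = (1 + cos \<theta>) * (1 - cos \<theta>)"
      using sin_squared_eq[of \<theta>] by (simp add: power2_eq_square algebra_simps)
    have "((\<lambda>\<theta>. (real n + 1) * (1 + cos \<theta>) ^ n * sin \<theta>) has_real_derivative
       (real n + 1) * ((1 + cos \<theta>) ^ n * cos \<theta> - real n * (1 + cos \<theta>) ^ m * (sin \<theta> * sin \<theta>))) (at \<theta>)"
      unfolding Suc
      using DERIV_power_Suc[of "\<lambda>\<theta>. 1 + cos \<theta>" "- sin \<theta>" \<theta> UNIV m]
      by (auto intro!: derivative_eq_intros simp: algebra_simps simp del: power_Suc)
    then show ?thesis unfolding s by (simp add: Suc algebra_simps)
  qed
  have d4: "((\<lambda>\<theta>. (\<Sum>k\<in>?I. ?c k * ?j k * sin (?j k * \<theta>)) / 2 ^ Suc n) has_real_derivative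
      (\<Sum>k\<in>?I. ?c k * (?j k)\<^sup>2 * cos (?j k * \<theta>)) / 2 ^ Suc n) (at \<theta>)"
    using has_real_derivative_sin_sum[where I = ?I and a = "\<lambda>k. ?c k * ?j k" and j = ?j]
    by (simp only: power2_eq_square mult.assoc)
  have "(real n + 1) * ((1 + cos \<theta>) ^ n * (1 - (real n + 1) * (1 - cos \<theta>))) =
      (\<Sum>k\<in>?I. ?c k * (?j k)\<^sup>2 * cos (?j k * \<theta>)) / 2 ^ Suc n"
    using DERIV_unique[OF d3 d4[folded first]] .
  moreover have "X = S / (N * P)" if "N * X = S / P" "N \<noteq> 0" for N X S P :: real
    using that by (metis divide_divide_eq_left' nonzero_mult_div_cancel_left)
  ultimately show ?thesis by simp
qed

section \<open>Two-sided bounds for the central binomial coefficient\<close>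

lemma central_binomial_step:
  "real (2 * Suc n choose Suc n) * (real n + 1) = real (2 * n choose n) * (2 * (2 * real n + 1))"
proof -
  have "Suc n * (2 * Suc n choose Suc n) = (2 * Suc n) * (Suc (2*n) choose n)"
    using Suc_times_binomial[of n "Suc (2*n)"] by simp
  moreover have "Suc n * (Suc (2*n) choose n) = Suc (2 * n) * (2 * n choose n)"
    using binomial_absorb_comp[of "Suc (2*n)" n] by simp
  ultimately have "Suc n * (Suc n * (2 * Suc n choose Suc n)) = Suc n * ((2 * n choose n) * (2 * Suc (2 * n)))"
    by (simp add: algebra_simps)
  then have "Suc n * (2 * Suc n choose Suc n) = (2 * n choose n) * (2 * Suc (2 * n))"
    by (metis mult_cancel1 nat.distinct(1))
  then have "real (Suc n * (2 * Suc n choose Suc n)) = real ((2 * n choose n) * (2 * Suc (2 * n)))"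
    by (rule arg_cong)
  then show ?thesis by (simp add: algebra_simps del: binomial_Suc_Suc)
qed

text \<open>Squaring the bound of order \<open>4 ^ n / sqrt n\<close> keeps square roots out of the
  induction, which becomes a polynomial inequality for the ratio of consecutive terms. It bounds the
  mean of the minorant from below.\<close>

lemma central_binomial_square_lower:
  "(4 ^ n)\<^sup>2 \<le> (4 * real n + 1) * (real (2 * n choose n))\<^sup>2"
proof (induction n)
  case (Suc n)
  let ?C = "real (2 * n choose n)" and ?D = "real (2 * Suc n choose Suc n)"
  have D: "?D = ?C * (2 * (2 * real n + 1)) / (real n + 1)"
    using central_binomial_step[of n] by (simp add: field_simps del: binomial_Suc_Suc)
  have "(4 ^ Suc n)\<^sup>2 = (16::real) * (4 ^ n)\<^sup>2" by (simp add: power_mult_distrib)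
  also have "\<dots> \<le> 16 * ((4 * real n + 1) * ?C\<^sup>2)" using Suc.IH by simp
  also have "\<dots> \<le> (4 * real (Suc n) + 1) * (2 * (2 * real n + 1) / (real n + 1))\<^sup>2 * ?C\<^sup>2"
  proof -
    have "16 * (4 * real n + 1) \<le> (4 * real (Suc n) + 1) * (2 * (2 * real n + 1) / (real n + 1))\<^sup>2"
      by (simp add: power_divide le_divide_eq) (simp add: algebra_simps power2_eq_square)
    then show ?thesis using mult_right_mono[of _ _ "?C\<^sup>2"] by (auto simp: mult_ac)
  qed
  also have "\<dots> = (4 * real (Suc n) + 1) * ?D\<^sup>2"
    unfolding D by (simp add: power_divide power_mult_distrib)
  finally show ?case .
qed simp

text \<open>The induction closes because
  \<open>(2 * n + 3) * (2 * n + 1) \<le> 4 * (n + 1)\<^sup>2\<close>. It bounds the mean of the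
  majorant of a gap from above.\<close>

lemma central_binomial_square_upper:
  "(2 * real n + 1) * (real (2 * n choose n))\<^sup>2 \<le> (4 ^ n)\<^sup>2"
proof (induction n)
  case (Suc n)
  let ?C = "real (2 * n choose n)" and ?D = "real (2 * Suc n choose Suc n)"
  have D: "?D = ?C * (2 * (2 * real n + 1)) / (real n + 1)"
    using central_binomial_step[of n] by (simp add: field_simps del: binomial_Suc_Suc)
  have "(2 * real (Suc n) + 1) * ?D\<^sup>2 = (2 * real (Suc n) + 1) * (2 * (2 * real n + 1) / (real n + 1))\<^sup>2 * ?C\<^sup>2"
    unfolding D by (simp add: power_divide power_mult_distrib)
  also have "\<dots> \<le> 16 * (2 * real n + 1) * ?C\<^sup>2"
  proof -
    have "(2 * real (Suc n) + 1) * (2 * (2 * real n + 1) / (real n + 1))\<^sup>2 \<le> 16 * (2 * real n + 1)"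
      by (simp add: power_divide divide_le_eq) (simp add: algebra_simps power2_eq_square)
    then show ?thesis by (rule mult_right_mono) simp
  qed
  also have "\<dots> \<le> 16 * (4 ^ n)\<^sup>2" using Suc.IH unfolding mult.assoc by (rule mult_left_mono) simp
  also have "\<dots> = (4 ^ Suc n)\<^sup>2" by (simp add: power_mult_distrib)
  finally show ?case .
qed simp

section \<open>Means of trigonometric polynomials\<close>

text \<open>Linearity and the triangle inequality. Vanishing coefficients are exempt from the
  smallness hypothesis so that frequency 0 may occur among the \<open>j k\<close>, as it does for
  the second derivative.\<close>

lemma trig_sum_integral_bound:
  fixes a j :: "'b \<Rightarrow> real" and w \<Theta> :: "'a \<Rightarrow> real"
  assumes "\<And>k. k \<in> I \<Longrightarrow> integrable \<mu> (\<lambda>x. w x * cos (j k * \<Theta> x))"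
    and a: "\<And>k. k \<in> I \<Longrightarrow> a k \<ge> 0"
    and small: "\<And>k. k \<in> I \<Longrightarrow> a k \<noteq> 0 \<Longrightarrow> \<bar>LINT x|\<mu>. w x * cos (j k * \<Theta> x)\<bar> \<le> \<epsilon>"
  shows "\<bar>LINT x|\<mu>. w x * (\<Sum>k\<in>I. a k * cos (j k * \<Theta> x))\<bar> \<le> \<epsilon> * sum a I"
proof -
  have "(LINT x|\<mu>. w x * (\<Sum>k\<in>I. a k * cos (j k * \<Theta> x))) =
      (LINT x|\<mu>. (\<Sum>k\<in>I. a k * (w x * cos (j k * \<Theta> x))))"
    by (simp add: sum_distrib_left mult_ac)
  also have "\<dots> = (\<Sum>k\<in>I. a k * (LINT x|\<mu>. w x * cos (j k * \<Theta> x)))"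
    using assms(1) by (simp add: Bochner_Integration.integral_sum)
  also have "\<bar>\<dots>\<bar> \<le> (\<Sum>k\<in>I. \<bar>a k * (LINT x|\<mu>. w x * cos (j k * \<Theta> x))\<bar>)"
    by (rule sum_abs)
  also have "\<dots> \<le> (\<Sum>k\<in>I. a k * \<epsilon>)"
  proof (rule sum_mono)
    fix k assume "k \<in> I"
    then show "\<bar>a k * (LINT x|\<mu>. w x * cos (j k * \<Theta> x))\<bar> \<le> a k * \<epsilon>"
      using a[of k] small[of k] by (cases "a k = 0") (auto simp: abs_mult intro!: mult_left_mono)
  qed
  finally show ?thesis by (simp add: sum_distrib_left mult.commute)
qed

text \<open>Serves two instances: \<open>w = 1\<close> for the mass of a gap, and a weight
  localizing near a point of the support for the union of the \<open>B\<^sub>n\<close>. Polynomials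
  in the phase \<open>\<Theta>\<close> then integrate to their constant coefficient times the mass
  of \<open>w\<close>, up to \<open>\<epsilon>\<close> times the sum of the other coefficients in
  absolute value.\<close>

context
  fixes \<mu> :: "'a measure" and w \<Theta> :: "'a \<Rightarrow> real" and \<epsilon> :: real
  assumes integrable_cos: "\<And>j::real. integrable \<mu> (\<lambda>x. w x * cos (j * \<Theta> x))"
    and coefficients_small: "\<And>i::int. i \<noteq> 0 \<Longrightarrow> \<bar>LINT x|\<mu>. w x * cos (of_int i * \<Theta> x)\<bar> \<le> \<epsilon>"
begin

lemma coefficients_small_centered:
  "k \<noteq> n \<Longrightarrow> \<bar>LINT x|\<mu>. w x * cos ((real k - real n) * \<Theta> x)\<bar> \<le> \<epsilon>"
  using coefficients_small[of "int k - int n"] by simp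

lemma integrable_one_plus_cos_power: "integrable \<mu> (\<lambda>x. w x * (1 + cos (\<Theta> x)) ^ n)"
proof -
  have "integrable \<mu> (\<lambda>x. \<Sum>k\<le>2*n. real (2*n choose k) / 2 ^ n * (w x * cos ((real k - real n) * \<Theta> x)))"
    using integrable_cos by (intro Bochner_Integration.integrable_sum integrable_mult_right) auto
  then show ?thesis
    unfolding one_plus_cos_power by (simp add: sum_distrib_left sum_divide_distrib mult_ac)
qed

text \<open>The term \<open>k = n\<close> is the constant one. The other coefficients are
  nonnegative, and together with it they add up to the value \<open>2 ^ n\<close> at
  \<open>\<theta> = 0\<close>.\<close>

lemma one_plus_cos_power_mean:
  "\<bar>(LINT x|\<mu>. w x * (1 + cos (\<Theta> x)) ^ n) - real (2*n choose n) / 2 ^ n * (LINT x|\<mu>. w x)\<bar>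
    \<le> \<epsilon> * 2 ^ n"
proof -
  let ?a = "\<lambda>k. real (2*n choose k) / 2 ^ n"
  let ?S = "\<lambda>x. \<Sum>k\<in>{..2*n} - {n}. ?a k * cos ((real k - real n) * \<Theta> x)"
  have split: "(1 + cos \<theta>) ^ n = ?a n + (\<Sum>k\<in>{..2*n} - {n}. ?a k * cos ((real k - real n) * \<theta>))" for \<theta> :: real
    unfolding one_plus_cos_power sum_divide_distrib
    by (subst sum.remove[of _ n]) auto
  have w: "integrable \<mu> w" using integrable_cos[of 0] by simp
  have eps: "\<epsilon> \<ge> 0" using coefficients_small[OF one_neq_zero] by linarith
  have "(LINT x|\<mu>. w x * (1 + cos (\<Theta> x)) ^ n) - ?a n * (LINT x|\<mu>. w x) =
      (LINT x|\<mu>. w x * (1 + cos (\<Theta> x)) ^ n - ?a n * w x)"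
    using w integrable_one_plus_cos_power by (subst Bochner_Integration.integral_diff) auto
  also have "\<dots> = (LINT x|\<mu>. w x * ?S x)"
    unfolding split by (simp add: algebra_simps)
  also have "\<bar>\<dots>\<bar> \<le> \<epsilon> * sum ?a ({..2*n} - {n})"
    using coefficients_small_centered integrable_cos by (intro trig_sum_integral_bound) auto
  also have "\<dots> \<le> \<epsilon> * (\<Sum>k\<le>2*n. ?a k)"
    using eps by (intro mult_left_mono sum_mono2) auto
  also have "(\<Sum>k\<le>2*n. ?a k) = 2 ^ n"
    using one_plus_cos_power[of 0 n] by (simp add: sum_divide_distrib)
  finally show ?thesis .
qed

lemma one_plus_cos_power_deriv2_mean:
  "\<bar>LINT x|\<mu>. w x * ((1 + cos (\<Theta> x)) ^ n * (1 - (real n + 1) * (1 - cos (\<Theta> x))))\<bar> \<le> \<epsilon> * 2 ^ n"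
proof -
  let ?a = "\<lambda>k. real (2*Suc n choose k) * (real k - real (Suc n))\<^sup>2 / ((real n + 1) * 2 ^ Suc n)"
  have eq: "(1 + cos \<theta>) ^ n * (1 - (real n + 1) * (1 - cos \<theta>)) =
     (\<Sum>k\<le>2*Suc n. ?a k * cos ((real k - real (Suc n)) * \<theta>))" for \<theta> :: real
    unfolding one_plus_cos_power_deriv2 sum_divide_distrib by (simp del: binomial_Suc_Suc)
  have "\<bar>LINT x|\<mu>. w x * (\<Sum>k\<le>2*Suc n. ?a k * cos ((real k - real (Suc n)) * \<Theta> x))\<bar>
      \<le> \<epsilon> * sum ?a {..2*Suc n}"
    using integrable_cos by (intro trig_sum_integral_bound coefficients_small_centered) auto
  also have "sum ?a {..2*Suc n} = 2 ^ n"
    using eq[of 0] by simp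
  finally show ?thesis unfolding eq .
qed

text \<open>
  The minorant \<open>(1 + cos \<theta>) ^ n * (2 - (n + 1) * (1 - cos \<theta>))\<close> is positive only on an arc of
  length of order \<open>1 / sqrt n\<close> around 0, but its constant coefficient exceeds the sum of the
  absolute values of all coefficients divided by a multiple of \<open>sqrt n\<close>.
\<close>

lemma integrable_minorant:
  "integrable \<mu> (\<lambda>x. w x * ((1 + cos (\<Theta> x)) ^ n * (2 - (real n + 1) * (1 - cos (\<Theta> x)))))"
proof -
  \<comment> \<open>As \<open>1 - cos \<theta> = 2 - (1 + cos \<theta>)\<close>, the minorant
    combines two consecutive powers of \<open>1 + cos \<theta>\<close>.\<close>
  have "w x * ((1 + cos (\<Theta> x)) ^ n * (2 - (real n + 1) * (1 - cos (\<Theta> x)))) =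
      (real n + 1) * (w x * (1 + cos (\<Theta> x)) ^ Suc n) - 2 * real n * (w x * (1 + cos (\<Theta> x)) ^ n)" for x
    by (simp add: algebra_simps)
  then show ?thesis
    by (simp only:) (intro Bochner_Integration.integrable_diff integrable_mult_right integrable_one_plus_cos_power)
qed

text \<open>The minorant is \<open>(1 + cos \<theta>) ^ n\<close> plus a multiple of a second
  derivative. The latter has mean zero, so it creates the negative part at no cost in the main term;
  each summand contributes an error \<open>\<epsilon> * 2 ^ n\<close>.\<close>

lemma minorant_mean:
  "(LINT x|\<mu>. w x * ((1 + cos (\<Theta> x)) ^ n * (2 - (real n + 1) * (1 - cos (\<Theta> x)))))
    \<ge> real (2*n choose n) / 2 ^ n * (LINT x|\<mu>. w x) - 2 * (\<epsilon> * 2 ^ n)"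
proof -
  let ?d = "\<lambda>x. w x * ((1 + cos (\<Theta> x)) ^ n * (1 - (real n + 1) * (1 - cos (\<Theta> x))))"
  have d_eq: "?d x = (real n + 1) * (w x * (1 + cos (\<Theta> x)) ^ Suc n) - (2 * real n + 1) * (w x * (1 + cos (\<Theta> x)) ^ n)" for x
    by (simp add: algebra_simps)
  have "integrable \<mu> ?d"
    unfolding d_eq using integrable_one_plus_cos_power
    by (intro Bochner_Integration.integrable_diff integrable_mult_right)
  moreover have "(LINT x|\<mu>. w x * ((1 + cos (\<Theta> x)) ^ n * (2 - (real n + 1) * (1 - cos (\<Theta> x))))) =
      (LINT x|\<mu>. w x * (1 + cos (\<Theta> x)) ^ n + ?d x)"
    by (simp add: algebra_simps)
  ultimately have "(LINT x|\<mu>. w x * ((1 + cos (\<Theta> x)) ^ n * (2 - (real n + 1) * (1 - cos (\<Theta> x))))) =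
      (LINT x|\<mu>. w x * (1 + cos (\<Theta> x)) ^ n) + (LINT x|\<mu>. ?d x)"
    using integrable_one_plus_cos_power by (simp add: Bochner_Integration.integral_add)
  moreover have "X \<ge> c - 2 * e" if "X = Y + Z" "\<bar>Y - c\<bar> \<le> e" "\<bar>Z\<bar> \<le> e" for X Y Z c e :: real
    using that by linarith
  ultimately show ?thesis
    using one_plus_cos_power_mean[of n] one_plus_cos_power_deriv2_mean[of n] by blast
qed

end

section \<open>Cosine integrals of measures with Fourier decay\<close>

lemma cos_integral_decay:
  fixes \<mu> :: "real measure"
  assumes "prob_space \<mu>" and sets: "sets \<mu> = sets borel"
    and decay: "\<And>\<xi>. \<xi> \<noteq> 0 \<Longrightarrow> norm (fourier_transform \<mu> \<xi>) \<le> M * norm \<xi> powr (- t / 2)"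
    and "\<gamma> \<noteq> 0"
  shows "\<bar>LINT x|\<mu>. cos (\<gamma> * x + \<delta>)\<bar> \<le> M * \<bar>\<gamma> / (2 * pi)\<bar> powr (- t / 2)"
proof -
  interpret prob_space \<mu> by fact
  have int: "integrable \<mu> (\<lambda>x. cis (\<gamma> * x + \<delta>))"
    by (rule integrable_const_bound[of _ 1])
       (auto intro!: borel_measurable_continuous_onI continuous_intros simp: measurable_cong_sets[OF sets refl])
  \<comment> \<open>The transform has kernel \<open>exp (- 2 * pi * \<i> * \<xi> * x)\<close>, hence
    the rescaled frequency with its sign; the phase \<open>\<delta>\<close> costs a factor of
    modulus 1.\<close>
  have "cis (\<gamma> * x) = exp (- 2 * complex_of_real pi * \<i> * complex_of_real ((- \<gamma> / (2 * pi)) \<bullet> x))" for x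
    by (simp add: cis_conv_exp)
  then have "fourier_transform \<mu> (- \<gamma> / (2 * pi)) = (LINT x|\<mu>. cis (\<gamma> * x))"
    unfolding fourier_transform_def by presburger
  then have "cis \<delta> * fourier_transform \<mu> (- \<gamma> / (2 * pi)) = (LINT x|\<mu>. cis (\<gamma> * x + \<delta>))"
    by (simp add: cis_mult[symmetric] mult.commute)
  then have "(LINT x|\<mu>. cos (\<gamma> * x + \<delta>)) = Re (cis \<delta> * fourier_transform \<mu> (- \<gamma> / (2 * pi)))"
    using integral_Re[OF int] by simp
  also have "\<bar>\<dots>\<bar> \<le> norm (cis \<delta> * fourier_transform \<mu> (- \<gamma> / (2 * pi)))"
    by (rule abs_Re_le_cmod)
  also have "\<dots> \<le> M * \<bar>\<gamma> / (2 * pi)\<bar> powr (- t / 2)"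
    using decay[of "- \<gamma> / (2 * pi)"] \<open>\<gamma> \<noteq> 0\<close> by (simp add: norm_mult)
  finally show ?thesis .
qed

text \<open>Expanding the weight replaces the frequency \<open>\<alpha>\<close> by an average over
  \<open>\<alpha> + j\<close> and \<open>\<alpha> - j\<close> with
  \<open>\<bar>j\<bar> \<le> N\<close>. The bound on \<open>N\<close> keeps these at least
  \<open>\<bar>\<alpha>\<bar> / 2\<close> in size, and the coefficients of the weight add up to
  1.\<close>

lemma weighted_cos_integral_decay:
  fixes \<mu> :: "real measure"
  assumes "prob_space \<mu>" and sets: "sets \<mu> = sets borel"
    and decay: "\<And>\<xi>. \<xi> \<noteq> 0 \<Longrightarrow> norm (fourier_transform \<mu> \<xi>) \<le> M * norm \<xi> powr (- t / 2)"
    and "t \<ge> 0" "M \<ge> 0" "\<alpha> \<noteq> 0" and N: "real N \<le> \<bar>\<alpha>\<bar> / 2"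
  shows "\<bar>LINT x|\<mu>. ((1 + cos (x - x0)) / 2) ^ N * cos (\<alpha> * x + \<beta>)\<bar>
    \<le> M * (\<bar>\<alpha>\<bar> / (4 * pi)) powr (- t / 2)"
proof -
  interpret prob_space \<mu> by fact
  let ?b = "M * (\<bar>\<alpha>\<bar> / (4 * pi)) powr (- t / 2)"
  have cos_int: "integrable \<mu> (\<lambda>x. cos (\<gamma> * x + \<delta>))" for \<gamma> \<delta>
    by (rule integrable_const_bound[of _ 1])
       (auto intro!: borel_measurable_continuous_onI continuous_intros simp: measurable_cong_sets[OF sets refl])
  have bound: "\<bar>LINT x|\<mu>. cos (\<gamma> * x + \<delta>)\<bar> \<le> ?b" if "\<bar>\<gamma>\<bar> \<ge> \<bar>\<alpha>\<bar> / 2" for \<gamma> \<delta>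
  proof -
    have "\<gamma> \<noteq> 0" using that \<open>\<alpha> \<noteq> 0\<close> by auto
    then have "\<bar>LINT x|\<mu>. cos (\<gamma> * x + \<delta>)\<bar> \<le> M * \<bar>\<gamma> / (2 * pi)\<bar> powr (- t / 2)"
      using cos_integral_decay assms by blast
    also have "\<dots> \<le> ?b"
      using that \<open>\<alpha> \<noteq> 0\<close> \<open>t \<ge> 0\<close> \<open>M \<ge> 0\<close>
      by (intro mult_left_mono powr_mono2') (auto simp: field_simps)
    finally show ?thesis .
  qed
  have expand: "((1 + cos \<theta>) / 2) ^ N =
      (\<Sum>k\<le>2*N. real (2*N choose k) / 4 ^ N * cos ((real k - real N) * \<theta>))" for \<theta>
    using power_mult_distrib[of 2 "2::real" N]
    by (simp add: power_divide one_plus_cos_power sum_divide_distrib)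
  have prod: "cos (j * (x - x0)) * cos (\<alpha> * x + \<beta>) =
      (cos ((\<alpha> - j) * x + (\<beta> + j * x0)) + cos ((\<alpha> + j) * x + (\<beta> - j * x0))) / 2" for j x
  proof -
    have "cos (j * (x - x0)) * cos (\<alpha> * x + \<beta>) = cos (\<alpha> * x + \<beta>) * cos (j * (x - x0))"
      by (rule mult.commute)
    also have "\<dots> = (cos ((\<alpha> - j) * x + (\<beta> + j * x0)) + cos ((\<alpha> + j) * x + (\<beta> - j * x0))) / 2"
      unfolding cos_times_cos by (simp add: algebra_simps)
    finally show ?thesis .
  qed
  have int: "integrable \<mu> (\<lambda>x. cos (\<alpha> * x + \<beta>) * cos (j * (x - x0)))" for j
    unfolding mult.commute[of "cos (\<alpha> * _ + \<beta>)"] prod using cos_int by auto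
  have "\<bar>LINT x|\<mu>. cos (\<alpha> * x + \<beta>) * (\<Sum>k\<le>2*N. real (2*N choose k) / 4 ^ N * cos ((real k - real N) * (x - x0)))\<bar>
      \<le> ?b * (\<Sum>k\<le>2*N. real (2*N choose k) / 4 ^ N)"
  proof (rule trig_sum_integral_bound)
    fix k assume k: "k \<in> {..2*N}"
    let ?j = "real k - real N"
    have "\<bar>?j\<bar> \<le> real N" using k by auto
    then have "\<bar>\<alpha>\<bar> / 2 \<le> \<bar>\<alpha> - ?j\<bar>" "\<bar>\<alpha>\<bar> / 2 \<le> \<bar>\<alpha> + ?j\<bar>"
      using N by linarith+
    note this(1)[THEN bound, of "\<beta> + ?j * x0"] this(2)[THEN bound, of "\<beta> - ?j * x0"]
    then show "\<bar>LINT x|\<mu>. cos (\<alpha> * x + \<beta>) * cos (?j * (x - x0))\<bar> \<le> ?b"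
      unfolding mult.commute[of "cos (\<alpha> * _ + \<beta>)"] prod using cos_int
      by (simp add: Bochner_Integration.integral_add)
  qed (use int in auto)
  also have "(\<Sum>k\<le>2*N. real (2*N choose k) / 4 ^ N) = 1"
    using expand[of 0] by simp
  finally show ?thesis
    unfolding expand by (simp only: mult.commute mult_1_right)
qed

section \<open>The gaps of the sets \<open>A\<^sub>k\<close>\<close>

text \<open>Multiplication by \<open>2 ^ l\<close> shifts the expansion: for
  \<open>i \<ge> 1\<close> the integer part of \<open>2 ^ l * x\<close> changes the floor by an even
  number only.\<close>

lemma bin_digit_eq_frac:
  assumes "x \<in> {0..<1}" "i \<ge> 1"
  shows "bin_digit x (l + i) = \<lfloor>2 ^ i * frac (2 ^ l * x)\<rfloor> mod 2"
proof -
  have "2 ^ (l + i) * x = 2 ^ i * frac (2 ^ l * x) + of_int (2 ^ i * \<lfloor>2 ^ l * x\<rfloor>)"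
    by (simp add: frac_def power_add algebra_simps)
  then have "\<lfloor>2 ^ (l + i) * x\<rfloor> = \<lfloor>2 ^ i * frac (2 ^ l * x)\<rfloor> + 2 ^ i * \<lfloor>2 ^ l * x\<rfloor>"
    by (metis floor_add_int)
  moreover obtain c where "2 ^ i * \<lfloor>2 ^ l * x\<rfloor> = 2 * c"
    using assms(2) by (metis dvd_def dvd_mult2 dvd_power less_eq_Suc_le One_nat_def)
  ultimately have "\<lfloor>2 ^ (l + i) * x\<rfloor> mod 2 = \<lfloor>2 ^ i * frac (2 ^ l * x)\<rfloor> mod 2"
    by simp
  then show ?thesis using assms(1) unfolding bin_digit_def by simp
qed

lemma zero_digits_iff:
  assumes x: "x \<in> {0..<1}"
  shows "map (bin_digit x) [l + 1 ..< l + m + 1] = replicate m 0 \<longleftrightarrow> frac (2 ^ l * x) < 1 / 2 ^ m"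
proof -
  let ?y = "frac (2 ^ l * x)"
  have "map (bin_digit x) [l + 1 ..< l + m + 1] = replicate m 0 \<longleftrightarrow>
      (\<forall>i\<in>{1..m}. bin_digit x (l + i) = 0)"
  proof -
    have "map (bin_digit x) [l + 1 ..< l + m + 1] = replicate m 0 \<longleftrightarrow>
        (\<forall>j<m. bin_digit x (l + Suc j) = 0)"
      by (simp add: list_eq_iff_nth_eq del: upt_Suc)
    also have "\<dots> \<longleftrightarrow> (\<forall>i\<in>Suc ` {..<m}. bin_digit x (l + i) = 0)" by auto
    also have "Suc ` {..<m} = {1..m}" by (simp add: image_Suc_lessThan)
    finally show ?thesis .
  qed
  also have "\<dots> \<longleftrightarrow> (\<forall>i\<in>{1..m}. \<lfloor>2 ^ i * ?y\<rfloor> mod 2 = 0)"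
    using bin_digit_eq_frac[OF x] by auto
  also have "\<dots> \<longleftrightarrow> 2 ^ m * ?y < 1"
  proof
    assume *: "\<forall>i\<in>{1..m}. \<lfloor>2 ^ i * ?y\<rfloor> mod 2 = 0"
    \<comment> \<open>Doubling a number in \<open>[0, 1)\<close> gives floor 0 or 1, and evenness
      leaves 0.\<close>
    have "i \<le> m \<Longrightarrow> 2 ^ i * ?y < 1" for i
    proof (induction i)
      case (Suc i)
      then have "2 ^ Suc i * ?y < 2" by simp
      moreover have "2 ^ Suc i * ?y \<ge> 0" by simp
      ultimately have "\<lfloor>2 ^ Suc i * ?y\<rfloor> = 0 \<or> \<lfloor>2 ^ Suc i * ?y\<rfloor> = 1" by linarith
      then have "\<lfloor>2 ^ Suc i * ?y\<rfloor> = 0" using *[rule_format, of "Suc i"] Suc.prems by auto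
      then show ?case by linarith
    qed (simp add: frac_lt_1)
    then show "2 ^ m * ?y < 1" by blast
  next
    assume *: "2 ^ m * ?y < 1"
    show "\<forall>i\<in>{1..m}. \<lfloor>2 ^ i * ?y\<rfloor> mod 2 = 0"
    proof
      fix i assume "i \<in> {1..m}"
      then have "2 ^ i * ?y \<le> 2 ^ m * ?y" by (intro mult_right_mono power_increasing) auto
      with * have "\<lfloor>2 ^ i * ?y\<rfloor> = 0" by (simp add: floor_eq_iff)
      then show "\<lfloor>2 ^ i * ?y\<rfloor> mod 2 = 0" by simp
    qed
  qed
  also have "\<dots> \<longleftrightarrow> ?y < 1 / 2 ^ m" by (simp add: field_simps)
  finally show ?thesis .
qed

lemma cos_two_pi_frac: "cos (2 * pi * z - h) = cos (2 * pi * frac z - h)"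
proof -
  have "cos (2 * pi * z - h) = cos ((2 * pi * frac z - h) + 2 * pi * of_int \<lfloor>z\<rfloor>)"
    by (simp add: frac_def algebra_simps)
  also have "\<dots> = cos (2 * pi * frac z - h)"
    by (simp only: cos_add cos_int_2pin sin_int_2pin)
  finally show ?thesis .
qed

text \<open>Subtracting \<open>h = pi / 2 ^ m\<close> centres the arc at phase 0, so its complement
  has phases in \<open>[h, 2 * pi - h]\<close>. Reflection about \<open>pi\<close> reduces
  everything to monotonicity of the cosine on \<open>[0, pi]\<close>.\<close>

lemma cos_le_off_arc:
  assumes "pi / 2 ^ m \<le> 2 * pi * y - pi / 2 ^ m" "y \<le> 1"
  shows "cos (2 * pi * y - pi / 2 ^ m) \<le> cos (pi / 2 ^ m)"
proof -
  let ?h = "pi / 2 ^ m"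
  let ?\<phi> = "2 * pi * y - ?h"
  have "2 * pi * y \<le> 2 * pi" using assms(2) by simp
  then have "?\<phi> \<le> 2 * pi - ?h" by linarith
  show ?thesis
  proof (cases "?\<phi> \<le> pi")
    case True
    then show ?thesis using assms(1) by (intro cos_monotone_0_pi_le) auto
  next
    case False
    then have "cos (2 * pi - ?\<phi>) \<le> cos ?h"
      using \<open>?\<phi> \<le> 2 * pi - ?h\<close> by (intro cos_monotone_0_pi_le) auto
    then show ?thesis by (simp only: cos_2pi_minus)
  qed
qed

lemma cos_ge_on_arc:
  assumes "0 \<le> y" "y < 1 / 2 ^ m"
  shows "cos (2 * pi * y - pi / 2 ^ m) \<ge> cos (pi / 2 ^ m)"
proof -
  have "2 * pi * y \<le> 2 * (pi / 2 ^ m)" "2 * pi * y \<ge> 0" using assms by (auto simp: field_simps)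
  then have "\<bar>2 * pi * y - pi / 2 ^ m\<bar> \<le> pi / 2 ^ m" by linarith
  moreover have "pi / 2 ^ m \<le> pi" by (simp add: divide_le_eq)
  ultimately have "cos \<bar>2 * pi * y - pi / 2 ^ m\<bar> \<ge> cos (pi / 2 ^ m)"
    by (intro cos_monotone_0_pi_le) auto
  then show ?thesis by simp
qed

text \<open>The inequality is a closed condition, so it passes from the set of digit strings to its
  closure.\<close>

lemma cos_le_on_A_set:
  assumes "x \<in> A_set b l k"
  shows "cos (2 * pi * (2 ^ l k * x) - pi / 2 ^ m_seq b l k) \<le> cos (pi / 2 ^ m_seq b l k)"
proof -
  let ?m = "m_seq b l k"
  let ?T = "{x. cos (2 * pi * (2 ^ l k * x) - pi / 2 ^ ?m) \<le> cos (pi / 2 ^ ?m)}"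
  have "closed ?T" by (intro closed_Collect_le continuous_intros)
  moreover have "{x \<in> {0..1}. map (bin_digit x) [l k + 1 ..< l k + ?m + 1] \<noteq> replicate ?m 0} \<subseteq> ?T"
  proof
    fix x assume "x \<in> {x \<in> {0..1}. map (bin_digit x) [l k + 1 ..< l k + ?m + 1] \<noteq> replicate ?m 0}"
    then have x: "x \<in> {0..1}" and digits: "map (bin_digit x) [l k + 1 ..< l k + ?m + 1] \<noteq> replicate ?m 0"
      by blast+
    have "cos (2 * pi * (2 ^ l k * x) - pi / 2 ^ ?m) \<le> cos (pi / 2 ^ ?m)"
    proof (cases "x = 1")
      \<comment> \<open>The point 1 is outside the scope of \<open>zero_digits_iff\<close>; its
        phase is an endpoint of the arc modulo \<open>2 * pi\<close>, where equality holds.\<close>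
      case True
      have "cos (2 * pi * 2 ^ l k - pi / 2 ^ ?m) = cos (pi / 2 ^ ?m)"
      proof -
        have "frac (2 ^ l k :: real) = 0" by (simp add: frac_eq_0_iff)
        then show ?thesis
          by (simp only: cos_two_pi_frac[of "2 ^ l k"] mult_zero_right diff_0 cos_minus)
      qed
      then show ?thesis unfolding True by (simp only: mult_1_right order_refl)
    next
      case False
      then have "frac (2 ^ l k * x) \<ge> 1 / 2 ^ ?m" using x digits zero_digits_iff[of x "l k" ?m] by auto
      then have "2 * pi * frac (2 ^ l k * x) \<ge> 2 * pi * (1 / 2 ^ ?m)" by (intro mult_left_mono) auto
      then show ?thesis
        unfolding cos_two_pi_frac[of "2 ^ l k * x"]
        by (intro cos_le_off_arc) (auto simp: frac_lt_1 less_imp_le)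
    qed
    then show "x \<in> ?T" by blast
  qed
  ultimately have "A_set b l k \<subseteq> ?T" unfolding A_set_def by (rule closure_minimal[rotated])
  then show ?thesis using assms by auto
qed

lemma frac_less_off_A_set:
  assumes "x \<in> {0..1} - A_set b l k" "m_seq b l k \<ge> 1"
  shows "x < 1" "frac (2 ^ l k * x) < 1 / 2 ^ m_seq b l k"
proof -
  let ?m = "m_seq b l k"
  have digits: "map (bin_digit x) [l k + 1 ..< l k + ?m + 1] = replicate ?m 0"
  proof (rule ccontr)
    assume "\<not> ?thesis"
    then have "x \<in> {x \<in> {0..1}. map (bin_digit x) [l k + 1 ..< l k + ?m + 1] \<noteq> replicate ?m 0}"
      using assms(1) by blast
    then have "x \<in> A_set b l k" unfolding A_set_def by (rule closure_subset[THEN subsetD])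
    then show False using assms(1) by blast
  qed
  \<comment> \<open>A nonempty block of zeros excludes 1, all of whose digits are 1.\<close>
  have "x \<noteq> 1"
  proof
    assume "x = 1"
    then have "map (bin_digit x) [l k + 1 ..< l k + ?m + 1] ! 0 = 1"
      using assms(2) by (simp add: bin_digit_def del: upt_Suc)
    then show False using digits assms(2) by simp
  qed
  then show "x < 1" using assms(1) by auto
  then show "frac (2 ^ l k * x) < 1 / 2 ^ ?m" using digits assms(1) zero_digits_iff by auto
qed

lemma A_set_subset: "A_set b l k \<subseteq> {0..1}"
  unfolding A_set_def by (rule closure_minimal) auto

lemma closed_A_set: "closed (A_set b l k)"
  unfolding A_set_def by simp

lemma compact_A_set: "compact (A_set b l k)"
  using closed_A_set A_set_subset compact_Int_closed[OF compact_Icc] by (metis inf.absorb2)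

lemma C_set_eq: "C_set b l = (\<Inter>n\<in>{1..}. \<Union>k\<in>{n..}. {0..1} - A_set b l k)"
  unfolding C_set_def B_set_def by fastforce

lemma B_set_subset: "B_set b l n \<subseteq> {0..1}"
  unfolding B_set_def using A_set_subset by fastforce

lemma compact_B_set: "compact (B_set b l n)"
proof -
  have "closed (B_set b l n)" unfolding B_set_def using closed_A_set by auto
  then show ?thesis using B_set_subset compact_Int_closed[OF compact_Icc] by (metis inf.absorb2)
qed

section \<open>Decaying measures do not charge \<open>C\<close>\<close>

lemma one_minus_square_half_le_cos: "1 - h\<^sup>2 / 2 \<le> cos (h::real)"
proof -
  have "(sin (h / 2))\<^sup>2 \<le> (h / 2)\<^sup>2"
    using abs_sin_x_le_abs_x[of "h / 2"] by (simp only: abs_le_square_iff)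
  then show ?thesis using cos_double_sin[of "h / 2"] by (simp add: power_divide)
qed

text \<open>In the normalization of the Fourier transform the frequency is \<open>i * 2 ^ L\<close>,
  of size at least \<open>2 ^ L\<close>; the phase \<open>h\<close> does not affect the
  bound.\<close>

lemma cos_frequency_decay:
  fixes \<mu> :: "real measure" and i :: int
  assumes "prob_space \<mu>" and "sets \<mu> = sets borel"
    and decay: "\<And>\<xi>. \<xi> \<noteq> 0 \<Longrightarrow> norm (fourier_transform \<mu> \<xi>) \<le> M * norm \<xi> powr (- t / 2)"
    and "t \<ge> 0" "M \<ge> 0" "i \<noteq> 0"
  shows "\<bar>LINT x|\<mu>. cos (of_int i * (2 * pi * (2 ^ L * x) - h))\<bar> \<le> M * 2 powr (- (t / 2) * real L)"
proof -
  have i: "1 \<le> \<bar>real_of_int i\<bar>" using \<open>i \<noteq> 0\<close> by linarith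
  have "of_int i * (2 * pi * (2 ^ L * x) - h) = (of_int i * 2 * pi * 2 ^ L) * x + (- of_int i * h)" for x
    by (simp add: algebra_simps)
  then have "\<bar>LINT x|\<mu>. cos (of_int i * (2 * pi * (2 ^ L * x) - h))\<bar>
      \<le> M * \<bar>of_int i * 2 * pi * 2 ^ L / (2 * pi)\<bar> powr (- t / 2)"
    using cos_integral_decay[OF assms(1,2) decay, of "of_int i * 2 * pi * 2 ^ L" "- of_int i * h"] i by simp
  also have "\<dots> \<le> M * (2 ^ L) powr (- t / 2)"
    using assms(4-6) i by (intro mult_left_mono powr_mono2') (auto simp: abs_mult mult_le_cancel_right1)
  also have "(2 ^ L) powr (- t / 2) = 2 powr (- (t / 2) * real L)"
    by (simp add: powr_realpow[symmetric] powr_powr mult.commute)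
  finally show ?thesis .
qed

text \<open>The majorant is \<open>(1 + cos \<Theta>) ^ n\<close> with \<open>n = 2 ^ m\<close>.
  This exponent, below the order \<open>4 ^ m\<close> matched to the arc, keeps Bernoulli's
  inequality effective on the gap; the normalized mean is then of order
  \<open>2 powr (- m / 2)\<close>, which suffices for summability.\<close>

lemma measure_gap_le:
  fixes \<mu> :: "real measure" and b :: real and l :: "nat \<Rightarrow> nat"
  defines "m \<equiv> m_seq b l"
  assumes "prob_space \<mu>" and sets: "sets \<mu> = sets borel"
    and decay: "\<And>\<xi>. \<xi> \<noteq> 0 \<Longrightarrow> norm (fourier_transform \<mu> \<xi>) \<le> M * norm \<xi> powr (- t / 2)"
    and "t \<ge> 0" "M \<ge> 0" and m1: "m k \<ge> 1"
  shows "measure \<mu> ({0..1} - A_set b l k) \<le> 4 * (2 powr (- real (m k) / 2) + M * 2 powr (- (t / 2) * real (l k)))"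
proof (cases "m k < 3")
  interpret prob_space \<mu> by fact
  case True
  \<comment> \<open>For \<open>m k \<le> 2\<close> the claimed bound is at least 2, so it holds for
    any probability.\<close>
  have "measure \<mu> ({0..1} - A_set b l k) \<le> 4 * 2 powr (- 1)"
    using order_trans[OF prob_le_1[of "{0..1} - A_set b l k"], of 2] by (simp add: powr_minus)
  also have "\<dots> \<le> 4 * 2 powr (- real (m k) / 2)"
    using True by (intro mult_left_mono powr_mono) auto
  finally show ?thesis using \<open>M \<ge> 0\<close> by (smt (verit) mult_nonneg_nonneg powr_ge_zero)
next
  interpret prob_space \<mu> by fact
  case False
  let ?h = "pi / 2 ^ m k"
  let ?\<Theta> = "\<lambda>x. 2 * pi * (2 ^ l k * x) - ?h"
  let ?n = "2 ^ m k :: nat"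
  let ?\<epsilon> = "M * 2 powr (- (t / 2) * real (l k))"
  have int: "integrable \<mu> (\<lambda>x. 1 * cos (j * ?\<Theta> x))" for j
    by (rule integrable_const_bound[of _ 1])
       (auto intro!: borel_measurable_continuous_onI continuous_intros simp: measurable_cong_sets[OF sets refl])
  have small: "\<bar>LINT x|\<mu>. 1 * cos (of_int i * ?\<Theta> x)\<bar> \<le> ?\<epsilon>" if "i \<noteq> 0" for i :: int
    using cos_frequency_decay[OF assms(2,3) decay] assms(5,6) that by simp
  have "(LINT x|\<mu>. (1 + cos (?\<Theta> x)) ^ ?n) \<le> real (2 * ?n choose ?n) / 2 ^ ?n + ?\<epsilon> * 2 ^ ?n"
    using one_plus_cos_power_mean[where w = "\<lambda>_. 1" and \<mu> = \<mu> and \<Theta> = ?\<Theta> and n = ?n, OF int small]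
    by (simp add: prob_space)
  moreover have "real (2 * ?n choose ?n) / 2 ^ ?n \<le> 2 powr (- real (m k) / 2) * 2 ^ ?n"
  proof -
    have "real ?n * (real (2 * ?n choose ?n))\<^sup>2 \<le> (2 * real ?n + 1) * (real (2 * ?n choose ?n))\<^sup>2"
      by (intro mult_right_mono) auto
    also note central_binomial_square_upper
    finally have "sqrt (real ?n * (real (2 * ?n choose ?n))\<^sup>2) \<le> sqrt ((4 ^ ?n)\<^sup>2)"
      by (rule real_sqrt_le_mono)
    then have "sqrt (real ?n) * real (2 * ?n choose ?n) \<le> 4 ^ ?n"
      by (simp add: real_sqrt_mult)
    moreover have "sqrt (real ?n) = 2 powr (real (m k) / 2)"
      by (simp add: powr_half_sqrt[symmetric] powr_realpow[symmetric] powr_powr)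
    ultimately have "real (2 * ?n choose ?n) \<le> 2 powr (- real (m k) / 2) * 4 ^ ?n"
      by (simp add: powr_minus field_simps)
    also have "(4::real) ^ ?n = 2 ^ ?n * 2 ^ ?n" by (simp add: power_mult_distrib[symmetric])
    finally show ?thesis by (simp add: field_simps)
  qed
  ultimately have upper: "(LINT x|\<mu>. (1 + cos (?\<Theta> x)) ^ ?n) \<le> (2 powr (- real (m k) / 2) + ?\<epsilon>) * 2 ^ ?n"
    by (simp add: algebra_simps)
  have lower: "indicator ({0..1} - A_set b l k) x * (2 ^ ?n / 4) \<le> (1 + cos (?\<Theta> x)) ^ ?n" for x
  proof (cases "x \<in> {0..1} - A_set b l k")
    case True
    \<comment> \<open>Here \<open>n * h\<^sup>2 / 4 = pi\<^sup>2 / (4 * 2 ^ m)\<close>, which is at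
      most 1/2 because \<open>2 ^ m \<ge> 8\<close> and \<open>pi < 4\<close>.\<close>
    have "1 / 2 \<le> 1 + real ?n * (- (?h\<^sup>2 / 4))"
    proof -
      have "(8::real) \<le> 2 ^ m k" using False power_increasing[of 3 "m k" "2::real"] by simp
      moreover have "pi\<^sup>2 \<le> 4\<^sup>2" using pi_less_4 by (intro power_mono) auto
      ultimately show ?thesis by (simp add: power_divide power2_eq_square field_simps)
    qed
    also have "\<dots> \<le> (1 + (- (?h\<^sup>2 / 4))) ^ ?n"
    proof (rule Bernoulli_inequality)
      have "?h \<le> 2" using m1 pi_less_4 power_increasing[of 1 "m k" "2::real"] by (simp add: divide_le_eq)
      then have "?h\<^sup>2 \<le> 2\<^sup>2" by (intro power_mono) auto
      then show "- 1 \<le> - (?h\<^sup>2 / 4)" by simp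
    qed
    also have "\<dots> \<le> ((1 + cos (?\<Theta> x)) / 2) ^ ?n"
    proof (rule power_mono)
      have "cos (?\<Theta> x) \<ge> cos ?h"
        unfolding cos_two_pi_frac[of "2 ^ l k * x"]
        using frac_less_off_A_set[OF True] m1 by (intro cos_ge_on_arc) (auto simp: m_def)
      then show "1 + - (?h\<^sup>2 / 4) \<le> (1 + cos (?\<Theta> x)) / 2"
        using one_minus_square_half_le_cos[of ?h] by simp
      have "?h \<le> 2" using m1 pi_less_4 power_increasing[of 1 "m k" "2::real"] by (simp add: divide_le_eq)
      then have "?h\<^sup>2 \<le> 2\<^sup>2" by (intro power_mono) auto
      then show "0 \<le> 1 + - (?h\<^sup>2 / 4)" by simp
    qed
    finally have "1 / 2 * 2 ^ ?n \<le> (1 + cos (?\<Theta> x)) ^ ?n"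
      by (simp add: power_divide field_simps)
    moreover have "(2::real) ^ ?n / 4 \<le> 1 / 2 * 2 ^ ?n" by simp
    ultimately have "(2::real) ^ ?n / 4 \<le> (1 + cos (?\<Theta> x)) ^ ?n" by (rule order_trans[rotated])
    then show ?thesis using True by (simp only: indicator_simps mult_1_left)
  next
    case False
    have "0 \<le> 1 + cos (?\<Theta> x)" using cos_ge_minus_one[of "?\<Theta> x"] by linarith
    then show ?thesis using False by simp
  qed
  have gap: "{0..1} - A_set b l k \<in> sets \<mu>"
    unfolding sets A_set_def by auto
  have "measure \<mu> ({0..1} - A_set b l k) * (2 ^ ?n / 4) =
      (LINT x|\<mu>. indicator ({0..1} - A_set b l k) x * (2 ^ ?n / 4))"
    using gap by (simp only: integral_mult_left_zero integral_indicator) simp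
  also have "\<dots> \<le> (LINT x|\<mu>. (1 + cos (?\<Theta> x)) ^ ?n)"
  proof (rule integral_mono)
    show "integrable \<mu> (\<lambda>x. indicator ({0..1} - A_set b l k) x * (2 ^ ?n / 4 :: real))"
      by (intro integrable_mult_left integrable_real_indicator gap) (simp add: less_top[symmetric])
    show "integrable \<mu> (\<lambda>x. (1 + cos (?\<Theta> x)) ^ ?n)"
      using integrable_one_plus_cos_power[where w = "\<lambda>_. 1", OF int small] by simp
  qed (rule lower)
  also note upper
  finally have "measure \<mu> ({0..1} - A_set b l k) * 2 ^ ?n \<le> (4 * (2 powr (- real (m k) / 2) + ?\<epsilon>)) * 2 ^ ?n"
    by (simp only: times_divide_eq_right mult.assoc divide_le_eq_numeral1 zero_less_numeral)
  then show ?thesis by (rule mult_right_le_imp_le) simp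
qed

text \<open>Indices start at 1 and \<open>l 1 = 0\<close> is allowed, hence the shift by
  one.\<close>

lemma strict_mono_on_ge_pred:
  fixes l :: "nat \<Rightarrow> nat"
  assumes "strict_mono_on {1..} l"
  shows "k \<le> l (Suc k)"
proof (induction k)
  case (Suc k)
  then show ?case using strict_mono_onD[OF assms, of "Suc k" "Suc (Suc k)"] by simp
qed simp

lemma m_seq_ge: "real (m_seq b l k) \<ge> b * real (l k)"
  unfolding m_seq_def by linarith

lemma m_seq_le: "b \<ge> 0 \<Longrightarrow> real (m_seq b l k) \<le> b * real (l k) + 1"
  unfolding m_seq_def by simp

lemma C_set_null:
  fixes \<mu> :: "real measure"
  assumes "b > 0" and l: "strict_mono_on {1..} l"
    and "prob_space \<mu>" and sets: "sets \<mu> = sets borel" and "fourier_decay \<mu> t" "t > 0"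
  shows "AE x in \<mu>. x \<notin> C_set b l"
proof -
  interpret prob_space \<mu> by fact
  obtain M where M: "\<xi> \<noteq> 0 \<Longrightarrow> norm (fourier_transform \<mu> \<xi>) \<le> M * norm \<xi> powr (- t / 2)" for \<xi>
    using \<open>fourier_decay \<mu> t\<close> unfolding fourier_decay_def by blast
  have "M \<ge> 0" using M[of 1] norm_ge_zero[of "fourier_transform \<mu> 1"] by (simp del: norm_ge_zero)
  \<comment> \<open>One shift skips the unconstrained value \<open>l 0\<close>; the other ensures
    \<open>l \<ge> 1\<close>, so that every block is nonempty.\<close>
  let ?G = "\<lambda>k. {0..1} - A_set b l (Suc (Suc k))"
  have le: "measure \<mu> (?G k) \<le> 4 * ((2 powr (- b / 2)) ^ k + M * (2 powr (- t / 2)) ^ k)" for k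
  proof -
    let ?k = "Suc (Suc k)"
    have lk: "real (l ?k) \<ge> real k" "l ?k \<ge> 1" using strict_mono_on_ge_pred[OF l, of "Suc k"] by auto
    have mk: "real (m_seq b l ?k) \<ge> b * real k"
      using m_seq_ge[of b l ?k] mult_left_mono[OF lk(1), of b] \<open>b > 0\<close> by linarith
    have "0 < b * real (l ?k)" using lk \<open>b > 0\<close> by simp
    then have "m_seq b l ?k \<ge> 1" using m_seq_ge[of b l ?k] by linarith
    then have "measure \<mu> (?G k) \<le> 4 * (2 powr (- real (m_seq b l ?k) / 2) + M * 2 powr (- (t / 2) * real (l ?k)))"
      using measure_gap_le[OF assms(3,4) M] \<open>t > 0\<close> \<open>M \<ge> 0\<close> by simp
    also have "\<dots> \<le> 4 * (2 powr ((- b / 2) * real k) + M * 2 powr ((- t / 2) * real k))"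
      using mk lk \<open>t > 0\<close> \<open>M \<ge> 0\<close>
      by (intro mult_left_mono add_mono powr_mono) (auto intro!: mult_left_mono)
    also have "\<dots> = 4 * ((2 powr (- b / 2)) ^ k + M * (2 powr (- t / 2)) ^ k)"
      by (simp add: powr_realpow[symmetric] powr_powr)
    finally show ?thesis .
  qed
  have "summable (\<lambda>k. 4 * ((2 powr (- b / 2)) ^ k + M * (2 powr (- t / 2)) ^ k))"
    using \<open>b > 0\<close> \<open>t > 0\<close>
    by (intro summable_mult summable_add summable_geometric) (auto simp: powr_less_one)
  then have "summable (\<lambda>k. measure \<mu> (?G k))"
    by (rule summable_comparison_test[rotated]) (use le in auto)
  then have "AE x in \<mu>. eventually (\<lambda>k. x \<in> space \<mu> - ?G k) sequentially"
    by (intro borel_cantelli_AE1) (auto simp: sets A_set_def emeasure_eq_measure)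
  then show ?thesis
  proof eventually_elim
    case (elim x)
    then obtain N where N: "\<And>k. k \<ge> N \<Longrightarrow> x \<notin> ?G k" unfolding eventually_sequentially by blast
    then have "x \<notin> {0..1} - A_set b l k" if "k \<ge> N + 2" for k
    proof -
      have "Suc (Suc (k - 2)) = k" "k - 2 \<ge> N" using that by auto
      then show ?thesis using N[of "k - 2"] by simp
    qed
    then have "x \<notin> (\<Union>k\<in>{N+2..}. {0..1} - A_set b l k)" by blast
    then show ?case unfolding C_set_eq by auto
  qed
qed

section \<open>Decaying measures on the union of the \<open>B\<^sub>n\<close>\<close>

text \<open>By the double-angle formula, halving the angle divides \<open>1 - cos\<close> by at most
  4; the induction starts from \<open>1 - cos pi = 2\<close>.\<close>

lemma one_minus_cos_pi_dyadic: "1 - cos (pi / 2 ^ m) \<ge> 2 / 4 ^ m"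
proof (induction m)
  case (Suc m)
  let ?c = "cos (pi / 2 ^ Suc m)"
  have "cos (pi / 2 ^ m) = 2 * ?c\<^sup>2 - 1"
    using cos_double_cos[of "pi / 2 ^ Suc m"] by simp
  then have "1 - cos (pi / 2 ^ m) = 2 * (1 - ?c) * (1 + ?c)"
    by (simp add: power2_eq_square algebra_simps)
  also have "\<dots> \<le> 2 * (1 - ?c) * 2"
    using cos_le_one[of "pi / 2 ^ Suc m"] by (intro mult_left_mono) auto
  finally show ?case using Suc by simp
qed simp

text \<open>The choice \<open>n + 1 = 4 ^ m\<close> makes the linear factor nonpositive as soon as
  \<open>1 - cos \<Theta> \<ge> 2 / 4 ^ m\<close>, which holds off the arc.\<close>

lemma minorant_le_on_A_set:
  fixes b :: real and l :: "nat \<Rightarrow> nat" and x :: real and k :: nat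
  defines "\<Theta> \<equiv> 2 * pi * (2 ^ l k * x) - pi / 2 ^ m_seq b l k"
  assumes "x \<in> A_set b l k" and n: "real n + 1 = 4 ^ m_seq b l k"
  shows "(1 + cos \<Theta>) ^ n * (2 - (real n + 1) * (1 - cos \<Theta>)) \<le> 0"
proof (rule mult_nonneg_nonpos)
  show "0 \<le> (1 + cos \<Theta>) ^ n" using cos_ge_minus_one[of \<Theta>] by (intro zero_le_power) linarith
  have "1 - cos \<Theta> \<ge> 2 / 4 ^ m_seq b l k"
    using cos_le_on_A_set[OF assms(2)] one_minus_cos_pi_dyadic[of "m_seq b l k"] unfolding \<Theta>_def by linarith
  then show "2 - (real n + 1) * (1 - cos \<Theta>) \<le> 0"
    unfolding n by (simp add: divide_le_eq mult.commute)
qed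

lemma minorant_le:
  "(1 + cos \<theta>) ^ n * (2 - (real n + 1) * (1 - cos \<theta>)) \<le> 2 * 2 ^ n"
proof -
  have "0 \<le> 1 + cos \<theta>" using cos_ge_minus_one[of \<theta>] by linarith
  then have p: "0 \<le> (1 + cos \<theta>) ^ n" "(1 + cos \<theta>) ^ n \<le> 2 ^ n"
    by (auto intro!: power_mono)
  have "2 - (real n + 1) * (1 - cos \<theta>) \<le> 2" by simp
  then have "(1 + cos \<theta>) ^ n * (2 - (real n + 1) * (1 - cos \<theta>)) \<le> (1 + cos \<theta>) ^ n * 2"
    using p(1) by (rule mult_left_mono)
  also have "\<dots> \<le> 2 * 2 ^ n" using p(2) by simp
  finally show ?thesis .
qed

text \<open>
  The weight \<open>((1 + cos (x - x0)) / 2) ^ N\<close> localizes near \<open>x0\<close>; as a trigonometric polynomial of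
  degree \<open>N\<close> it shifts frequencies by at most \<open>N\<close>, hence preserves the decay at frequencies above \<open>2 * N\<close>.
\<close>

lemma weighted_mean_le:
  fixes \<mu> :: "real measure" and b :: real and l :: "nat \<Rightarrow> nat"
  assumes "prob_space \<mu>" and sets: "sets \<mu> = sets borel"
    and decay: "\<And>\<xi>. \<xi> \<noteq> 0 \<Longrightarrow> norm (fourier_transform \<mu> \<xi>) \<le> M * norm \<xi> powr (- t / 2)"
    and "t \<ge> 0" "M \<ge> 0" and N: "real N \<le> 2 ^ l k"
    and off: "AE x in \<mu>. x \<in> A_set b l k \<or> (1 + cos (x - x0)) / 2 \<le> \<rho>" and "\<rho> \<ge> 0"
  shows "(LINT x|\<mu>. ((1 + cos (x - x0)) / 2) ^ N) \<le>
    4 * 2 ^ m_seq b l k * (\<rho> ^ N + M * 2 powr (t / 2) * 2 powr (- (t / 2) * real (l k)))"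
proof -
  interpret prob_space \<mu> by fact
  let ?m = "m_seq b l k"
  let ?h = "pi / 2 ^ ?m"
  let ?\<Theta> = "\<lambda>x. 2 * pi * (2 ^ l k * x) - ?h"
  let ?w = "\<lambda>x. ((1 + cos (x - x0)) / 2) ^ N"
  let ?\<epsilon> = "M * 2 powr (t / 2) * 2 powr (- (t / 2) * real (l k))"
  define n :: nat where "n = 4 ^ ?m - 1"
  have n: "real n + 1 = 4 ^ ?m" unfolding n_def by (simp add: of_nat_diff)
  let ?q = "\<lambda>x. (1 + cos (?\<Theta> x)) ^ n * (2 - (real n + 1) * (1 - cos (?\<Theta> x)))"
  note w0 = half_one_plus_cos_bounds(1)[of "_ - x0"]
  have int: "integrable \<mu> (\<lambda>x. ?w x * cos (j * ?\<Theta> x))" for j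
  proof (rule integrable_const_bound[of _ 1])
    show "AE x in \<mu>. norm (?w x * cos (j * ?\<Theta> x)) \<le> 1"
      using abs_half_one_plus_cos_power_le[of "_ - x0" N] abs_cos_le_one
      by (auto simp only: real_norm_def abs_mult abs_ge_zero intro!: mult_le_one)
  qed (auto intro!: borel_measurable_continuous_onI continuous_intros simp: measurable_cong_sets[OF sets refl])
  have small: "\<bar>LINT x|\<mu>. ?w x * cos (of_int i * ?\<Theta> x)\<bar> \<le> ?\<epsilon>" if "i \<noteq> 0" for i :: int
  proof -
    have i: "1 \<le> \<bar>real_of_int i\<bar>" using that by linarith
    let ?\<alpha> = "of_int i * 2 * pi * 2 ^ l k :: real"
    have \<alpha>: "2 * pi * 2 ^ l k \<le> \<bar>?\<alpha>\<bar>" using i by (simp add: abs_mult)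
    have "of_int i * ?\<Theta> x = ?\<alpha> * x + (- of_int i * ?h)" for x
      by (simp add: algebra_simps)
    moreover have "real N \<le> \<bar>?\<alpha>\<bar> / 2"
    proof -
      have "2 ^ l k * 1 \<le> 2 ^ l k * pi" using pi_ge_two by (intro mult_left_mono) auto
      moreover have "2 * pi * 2 ^ l k = 2 * (2 ^ l k * pi)" by (simp only: mult_ac)
      ultimately show ?thesis using N \<alpha> by linarith
    qed
    ultimately have "\<bar>LINT x|\<mu>. ?w x * cos (of_int i * ?\<Theta> x)\<bar> \<le> M * (\<bar>?\<alpha>\<bar> / (4 * pi)) powr (- t / 2)"
      using weighted_cos_integral_decay[OF assms(1,2) decay assms(4,5), of ?\<alpha> N x0 "- of_int i * ?h"] i by simp
    \<comment> \<open>The weight may halve the frequency \<open>2 ^ l k\<close>; this is the source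
      of the factor \<open>2 powr (t / 2)\<close>.\<close>
    also have "\<dots> \<le> M * (2 powr (real (l k) - 1)) powr (- t / 2)"
    proof (intro mult_left_mono powr_mono2')
      show "2 powr (real (l k) - 1) \<le> \<bar>?\<alpha>\<bar> / (4 * pi)"
        using \<alpha> by (simp add: powr_diff powr_realpow field_simps)
    qed (use assms(4,5) in auto)
    also have "(2 powr (real (l k) - 1)) powr (- t / 2) = 2 powr (t / 2) * 2 powr (- (t / 2) * real (l k))"
      unfolding powr_powr powr_add[symmetric]
      by (rule arg_cong[where f = "(powr) 2"]) (simp add: field_simps)
    finally show ?thesis by (simp only: mult.assoc)
  qed
  have w_int: "integrable \<mu> ?w" using int[of 0] by simp
  \<comment> \<open>On \<open>A\<^sub>k\<close> the minorant is nonpositive; elsewhere the weight is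
    at most \<open>\<rho> ^ N\<close> and the minorant at most \<open>2 * 2 ^ n\<close>.\<close>
  have "?w x * ?q x \<le> 2 * 2 ^ n * \<rho> ^ N" if "x \<in> A_set b l k \<or> (1 + cos (x - x0)) / 2 \<le> \<rho>" for x
    using that
  proof
    assume "x \<in> A_set b l k"
    then have "?w x * ?q x \<le> 0"
      using w0 n by (intro mult_nonneg_nonpos[OF zero_le_power minorant_le_on_A_set])
    then show ?thesis using \<open>\<rho> \<ge> 0\<close> by (meson mult_nonneg_nonneg order_trans zero_le_numeral zero_le_power)
  next
    assume "(1 + cos (x - x0)) / 2 \<le> \<rho>"
    then have "?w x \<le> \<rho> ^ N" using w0 by (intro power_mono)
    have "?w x * ?q x \<le> ?w x * (2 * 2 ^ n)"
      using w0 by (intro mult_left_mono minorant_le zero_le_power)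
    also have "\<dots> \<le> \<rho> ^ N * (2 * 2 ^ n)" using \<open>?w x \<le> \<rho> ^ N\<close> by (intro mult_right_mono) auto
    finally show ?thesis by (simp only: mult.commute)
  qed
  then have "AE x in \<mu>. ?w x * ?q x \<le> 2 * 2 ^ n * \<rho> ^ N"
    using off by (auto elim: eventually_mono)
  then have "(LINT x|\<mu>. ?w x * ?q x) \<le> 2 * 2 ^ n * \<rho> ^ N"
    using \<open>\<rho> \<ge> 0\<close> by (intro integral_le_const integrable_minorant[OF int small])
  \<comment> \<open>Since \<open>4 * n + 1 \<le> 4 * 4 ^ m\<close>, the normalized mean of the
    minorant loses only a factor of order \<open>2 ^ m\<close>.\<close>
  moreover have "2 ^ n / (2 * 2 ^ ?m) \<le> real (2 * n choose n) / 2 ^ n"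
  proof -
    have "(4 ^ n)\<^sup>2 \<le> (4 * real n + 1) * (real (2 * n choose n))\<^sup>2"
      by (rule central_binomial_square_lower)
    also have "\<dots> \<le> (4 * 4 ^ ?m) * (real (2 * n choose n))\<^sup>2"
      using n by (intro mult_right_mono) auto
    also have "\<dots> = (2 * 2 ^ ?m * real (2 * n choose n))\<^sup>2"
      by (simp add: power_mult_distrib power_mult[symmetric] mult.commute[of _ 2]) (simp add: power_mult)
    finally have "4 ^ n \<le> 2 * 2 ^ ?m * real (2 * n choose n)" by (rule power2_le_imp_le) simp
    moreover have "(4::real) ^ n = 2 ^ n * 2 ^ n" by (simp add: power_mult_distrib[symmetric])
    ultimately show ?thesis by (simp add: field_simps)
  qed
  then have "2 ^ n / (2 * 2 ^ ?m) * (LINT x|\<mu>. ?w x) \<le> real (2 * n choose n) / 2 ^ n * (LINT x|\<mu>. ?w x)"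
    using w0 by (intro mult_right_mono Bochner_Integration.integral_nonneg zero_le_power)
  moreover have "(LINT x|\<mu>. ?w x * ?q x) \<ge> real (2*n choose n) / 2 ^ n * (LINT x|\<mu>. ?w x) - 2 * (?\<epsilon> * 2 ^ n)"
    by (rule minorant_mean[OF int small])
  ultimately have "2 ^ n / (2 * 2 ^ ?m) * (LINT x|\<mu>. ?w x) \<le> 2 ^ n * (2 * (\<rho> ^ N + ?\<epsilon>))"
    by (simp only: distrib_left mult_ac)
  then have "(LINT x|\<mu>. ?w x) / (2 * 2 ^ ?m) \<le> 2 * (\<rho> ^ N + ?\<epsilon>)"
    by (simp only: times_divide_eq_left times_divide_eq_right[symmetric]) (rule mult_left_le_imp_le, auto)
  then show ?thesis by (simp add: field_simps)
qed

text \<open>By Lindelof the union of all open null sets is a countable union of such sets. Its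
  complement is the support.\<close>

lemma largest_open_null_set:
  fixes \<mu> :: "'a :: second_countable_topology measure"
  assumes sets: "sets \<mu> = sets borel"
  obtains N where "open N" "N \<in> null_sets \<mu>" "\<And>U. open U \<Longrightarrow> U \<in> null_sets \<mu> \<Longrightarrow> U \<subseteq> N"
proof -
  let ?F = "{U. open U \<and> U \<in> null_sets \<mu>}"
  obtain G where "G \<subseteq> ?F" "countable G" "\<Union>G = \<Union>?F"
    using Lindelof[of ?F] by auto
  moreover from this have "\<Union>G \<in> null_sets \<mu>" 
    using null_sets_UN'[of G "\<lambda>U. U" \<mu>] by auto
  ultimately have "\<Union>?F \<in> null_sets \<mu>" by simp
  moreover have "open (\<Union>?F)" by auto
  ultimately show ?thesis using that by blast
qed

text \<open>Baire's theorem on the support \<open>- N\<close>, a closed subset of \<open>K\<close>: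
  if every \<open>- N - F n\<close> were dense in it, their intersection would be dense too, yet it
  is empty because the \<open>F n\<close> cover \<open>K\<close>.\<close>

lemma locally_concentrated_on_member:
  fixes \<mu> :: "'a :: euclidean_space measure"
  assumes "prob_space \<mu>" and sets: "sets \<mu> = sets borel"
    and K: "compact K" "emeasure \<mu> K = 1" "K \<subseteq> (\<Union>n\<in>I. F n)"
    and F: "countable I" "\<And>n. n \<in> I \<Longrightarrow> closed (F n)"
  obtains x0 r n where "x0 \<in> K" "r > 0" "n \<in> I" "\<And>U. open U \<Longrightarrow> x0 \<in> U \<Longrightarrow> measure \<mu> U > 0"
    "AE x in \<mu>. x \<in> K \<and> (x \<in> ball x0 r \<longrightarrow> x \<in> F n)"
proof -
  interpret prob_space \<mu> by fact
  obtain N where N: "open N" "N \<in> null_sets \<mu>" "\<And>U. open U \<Longrightarrow> U \<in> null_sets \<mu> \<Longrightarrow> U \<subseteq> N"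
    using largest_open_null_set[OF sets] by blast
  have "AE x in \<mu>. x \<in> K"
    using K(1,2) by (subst prob_eq_1[symmetric]) (auto simp: sets compact_imp_closed emeasure_eq_measure)
  then have "- K \<in> null_sets \<mu>"
    using K(1) by (auto simp: AE_iff_null sets sets_eq_imp_space_eq[OF sets] Compl_eq[symmetric] compact_imp_closed)
  then have "- N \<subseteq> K" using N(3)[of "- K"] K(1) compact_imp_closed by blast
  have "- N \<noteq> {}"
  proof
    assume "- N = {}"
    then have "N = space \<mu>" using sets_eq_imp_space_eq[OF sets] by auto
    then show False using N(2) emeasure_space_1 by auto
  qed
  have "\<exists>n\<in>I. \<not> - N \<subseteq> closure (- N - F n)"
  proof (rule ccontr)
    assume contra: "\<not> ?thesis"
    let ?G = "(\<lambda>n. - N - F n) ` I"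
    have "- N \<subseteq> closure (\<Inter>?G)"
    proof (rule Baire)
      fix T assume "T \<in> ?G"
      then obtain n where "n \<in> I" "T = - N \<inter> - F n" by blast
      then show "openin (top_of_set (- N)) T \<and> - N \<subseteq> closure T"
        using contra F(2) by (auto simp: Diff_eq intro!: openin_open_Int)
    qed (use N(1) F(1) in auto)
    moreover have "\<Inter>?G = {}"
    proof -
      have "I \<noteq> {}" using \<open>- N \<subseteq> K\<close> \<open>- N \<noteq> {}\<close> K(3) by auto
      then obtain i where "i \<in> I" by blast
      have False if "x \<in> \<Inter>?G" for x
      proof -
        have "x \<in> - N" using that \<open>i \<in> I\<close> by blast
        then obtain j where "j \<in> I" "x \<in> F j" using \<open>- N \<subseteq> K\<close> K(3) by blast
        then show False using that by blast
      qed
      then show ?thesis by blast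
    qed
    ultimately show False using \<open>- N \<noteq> {}\<close> by simp
  qed
  \<comment> \<open>Near this \<open>x0\<close> every point of the support belongs to
    \<open>F n\<close>.\<close>
  then obtain n x0 where n: "n \<in> I" and x0: "x0 \<in> - N" "x0 \<in> - closure (- N - F n)" by blast
  then obtain r where r: "r > 0" "ball x0 r \<subseteq> - closure (- N - F n)"
    using open_contains_ball[of "- closure (- N - F n)"] by auto
  show ?thesis
  proof (rule that[of x0 r n])
    show "measure \<mu> U > 0" if "open U" "x0 \<in> U" for U
    proof (rule ccontr)
      assume "\<not> measure \<mu> U > 0"
      then have "measure \<mu> U = 0" using measure_nonneg[of \<mu> U] by linarith
      then have "U \<in> null_sets \<mu>" using that(1) by (auto simp: null_sets_def sets emeasure_eq_measure)
      then show False using N(3) that x0(1) by blast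
    qed
    have "AE x in \<mu>. x \<notin> N" using N(2) by (rule AE_not_in)
    then show "AE x in \<mu>. x \<in> K \<and> (x \<in> ball x0 r \<longrightarrow> x \<in> F n)"
    proof eventually_elim
      case (elim x)
      then show ?case using r(2) closure_subset[of "- N - F n"] \<open>- N \<subseteq> K\<close> by blast
    qed
  qed (use x0 r n \<open>- N \<subseteq> K\<close> in auto)
qed

lemma strict_mono_on_filterlim:
  fixes l :: "nat \<Rightarrow> nat"
  assumes "strict_mono_on {1..} l"
  shows "filterlim l at_top at_top"
proof -
  have "eventually (\<lambda>k. k - 1 \<le> l k) at_top"
    using eventually_ge_at_top[of 1]
  proof eventually_elim
    case (elim k)
    then show ?case using strict_mono_on_ge_pred[OF assms, of "k - 1"] by simp
  qed
  moreover have "filterlim (\<lambda>k. k - 1 :: nat) at_top at_top" by (rule filterlim_minus_const_nat_at_top)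
  ultimately show ?thesis using filterlim_at_top_mono by blast
qed

text \<open>
  The union itself carries measures with optimal decay (such as Lebesgue measure), so compactness
  is essential: Baire's theorem, applied to the support, localizes the measure to a single \<open>B\<^sub>n\<close>.
\<close>

lemma no_decay_on_Union_B_set:
  fixes \<mu> :: "real measure"
  assumes "b > 0" and l: "strict_mono_on {1..} l"
    and "prob_space \<mu>" and sets: "sets \<mu> = sets borel"
    and K: "compact K" "K \<subseteq> (\<Union>n\<in>{1..}. B_set b l n)" "emeasure \<mu> K = 1"
    and "fourier_decay \<mu> t" "t > 2 * b"
  shows False
proof -
  interpret prob_space \<mu> by fact
  have two_powr_mult: "2 powr (a * real n) = (2 powr a) ^ n" for a :: real and n
    by (simp add: powr_realpow[symmetric] powr_powr)
  obtain M where M: "\<xi> \<noteq> 0 \<Longrightarrow> norm (fourier_transform \<mu> \<xi>) \<le> M * norm \<xi> powr (- t / 2)" for \<xi>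
    using \<open>fourier_decay \<mu> t\<close> unfolding fourier_decay_def by blast
  have "M \<ge> 0" using M[of 1] norm_ge_zero[of "fourier_transform \<mu> 1"] by (simp del: norm_ge_zero)
  have closed_B: "closed (B_set b l n)" for n using compact_B_set compact_imp_closed by blast
  obtain x0 r n0 where "x0 \<in> K" "r > 0" "n0 \<in> {1..}"
    and pos: "\<And>U. open U \<Longrightarrow> x0 \<in> U \<Longrightarrow> measure \<mu> U > 0"
    and conc: "AE x in \<mu>. x \<in> K \<and> (x \<in> ball x0 r \<longrightarrow> x \<in> B_set b l n0)"
    by (rule locally_concentrated_on_member[OF assms(3,4) K(1,3,2) countableI_type closed_B]) blast
  have K01: "K \<subseteq> {0..1}" using K(2) B_set_subset by blast
  \<comment> \<open>Bounds the base of the weight outside \<open>ball x0 r\<close> on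
    \<open>K\<close>, where distances are at most 1. The cap keeps the angle in the range where the
    cosine decreases.\<close>
  define \<rho> where "\<rho> = (1 + cos (min r 1)) / 2"
  have \<rho>: "0 \<le> \<rho>" "\<rho> < 1"
  proof -
    have "cos (min r 1) < cos 0"
      using \<open>r > 0\<close> pi_gt3 by (intro cos_monotone_0_pi) auto
    then show "0 \<le> \<rho>" "\<rho> < 1"
      unfolding \<rho>_def using half_one_plus_cos_bounds(1)[of "min r 1"] by auto
  qed
  have off: "AE x in \<mu>. x \<in> A_set b l k \<or> (1 + cos (x - x0)) / 2 \<le> \<rho>" if "k \<ge> n0" for k
    using conc
  proof eventually_elim
    case (elim x)
    show ?case
    proof (cases "x \<in> ball x0 r")
      case True
      then show ?thesis using elim that unfolding B_set_def by auto
    next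
      case False
      then have "min r 1 \<le> \<bar>x - x0\<bar>" by (simp add: dist_real_def)
      moreover have "x \<in> {0..1}" "x0 \<in> {0..1}" using elim \<open>x0 \<in> K\<close> K01 by blast+
      then have "\<bar>x - x0\<bar> \<le> pi" using pi_gt3 unfolding atLeastAtMost_iff by linarith
      ultimately have "cos \<bar>x - x0\<bar> \<le> cos (min r 1)"
        using \<open>r > 0\<close> by (intro cos_monotone_0_pi_le) auto
      then show ?thesis unfolding \<rho>_def by simp
    qed
  qed
  \<comment> \<open>With degree \<open>N = C * l k\<close>, the weight away from \<open>x0\<close>
    is as small as the Fourier error \<open>2 powr (- (t / 2) * l k)\<close>.\<close>
  obtain C where C: "\<rho> ^ C < 2 powr (- (t / 2))"
    using real_arch_pow_inv[of "2 powr (- (t / 2))" \<rho>] \<rho> by auto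
  \<comment> \<open>The rates are tuned so that \<open>\<sigma> ^ C \<ge> 2 powr (- d)\<close> while the upper bound for the weighted mean
    decays like \<open>(2 powr (- 2 * d)) ^ l k\<close>.\<close>
  define d where "d = (t / 2 - b) / 2"
  have "d > 0" using \<open>t > 2 * b\<close> unfolding d_def by simp
  define \<sigma> where "\<sigma> = 2 powr (- d / (real C + 1))"
  have \<sigma>: "0 < \<sigma>" "\<sigma> < 1" using \<open>d > 0\<close> unfolding \<sigma>_def by (auto simp: powr_less_one)
  have \<sigma>C: "2 powr (- d) \<le> \<sigma> ^ C"
  proof -
    have "- d \<le> - d / (real C + 1) * real C" using \<open>d > 0\<close> by (simp add: field_simps)
    then have "2 powr (- d) \<le> 2 powr (- d / (real C + 1) * real C)" by (intro powr_mono) auto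
    also have "\<dots> = \<sigma> ^ C" unfolding \<sigma>_def by (rule two_powr_mult)
    finally show ?thesis .
  qed
  \<comment> \<open>A neighbourhood of \<open>x0\<close>, where the base equals 1; on it the weight
    is at least \<open>\<sigma> ^ N\<close>.\<close>
  define U where "U = {x. \<sigma> < (1 + cos (x - x0)) / 2}"
  have "open U" unfolding U_def by (intro open_Collect_less continuous_intros) simp
  have U_pos: "measure \<mu> U > 0" using \<open>open U\<close> \<sigma> by (intro pos) (auto simp: U_def)
  define c where "c = 8 * (1 + M * 2 powr (t / 2))"
  \<comment> \<open>The condition \<open>small\<close> is the degree restriction of
    \<open>weighted_mean_le\<close>; it holds for all large \<open>k\<close>.\<close>
  have bound: "measure \<mu> U \<le> c * (2 powr (- d)) ^ l k"
    if k: "k \<ge> n0" and small: "real C * real (l k) \<le> 2 ^ l k" for k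
  proof -
    let ?N = "C * l k" and ?w = "\<lambda>x. ((1 + cos (x - x0)) / 2) ^ (C * l k)"
    let ?q = "2 powr (- (t / 2)) :: real"
    note nonneg = half_one_plus_cos_bounds
    have "integrable \<mu> ?w"
    proof (rule integrable_const_bound[of _ 1])
      show "AE x in \<mu>. norm (?w x) \<le> 1"
        unfolding real_norm_def by (intro always_eventually allI abs_half_one_plus_cos_power_le)
    qed (auto intro!: borel_measurable_continuous_onI continuous_intros simp: measurable_cong_sets[OF sets refl])
    have "U \<in> sets \<mu>" using \<open>open U\<close> sets by auto
    have "(2 powr (- d)) ^ l k * measure \<mu> U \<le> \<sigma> ^ ?N * measure \<mu> U"
      unfolding power_mult using \<sigma>C by (intro mult_right_mono power_mono) auto
    also have "\<dots> = (LINT x|\<mu>. indicator U x * \<sigma> ^ ?N)"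
      using \<open>U \<in> sets \<mu>\<close> by (simp only: integral_mult_left_zero integral_indicator) (simp add: mult.commute)
    also have "\<dots> \<le> (LINT x|\<mu>. ?w x)"
    proof (rule integral_mono)
      show "integrable \<mu> (\<lambda>x. indicator U x * \<sigma> ^ ?N)"
        using \<open>U \<in> sets \<mu>\<close> by (intro integrable_mult_left integrable_real_indicator) (auto simp: less_top[symmetric])
      show "indicator U x * \<sigma> ^ ?N \<le> ?w x" for x
        using \<sigma>(1) nonneg(1)[of "x - x0"]
        by (cases "x \<in> U") (auto simp: U_def intro!: power_mono zero_le_power simp del: power_divide)
    qed fact
    also have "\<dots> \<le> 4 * 2 ^ m_seq b l k * (\<rho> ^ ?N + M * 2 powr (t / 2) * 2 powr (- (t / 2) * real (l k)))"
      using small \<open>M \<ge> 0\<close> \<open>b > 0\<close> \<open>t > 2 * b\<close> \<rho>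
      by (intro weighted_mean_le[OF assms(3,4) M _ _ _ off[OF k]]) auto
    also have "2 powr (- (t / 2) * real (l k)) = ?q ^ l k" by (rule two_powr_mult)
    also have "4 * 2 ^ m_seq b l k * (\<rho> ^ ?N + M * 2 powr (t / 2) * ?q ^ l k)
        \<le> 4 * (2 * (2 powr b) ^ l k) * (?q ^ l k + M * 2 powr (t / 2) * ?q ^ l k)"
    proof (intro mult_mono add_mono order_refl)
      have "(2::real) ^ m_seq b l k = 2 powr (real (m_seq b l k))" by (simp add: powr_realpow)
      also have "\<dots> \<le> 2 powr (b * real (l k) + 1)"
        using m_seq_le[of b l k] \<open>b > 0\<close> by (intro powr_mono) auto
      also have "\<dots> = 2 * (2 powr b) ^ l k" by (simp add: powr_add two_powr_mult)
      finally show "(2::real) ^ m_seq b l k \<le> 2 * (2 powr b) ^ l k" .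
      show "\<rho> ^ ?N \<le> ?q ^ l k"
        unfolding power_mult using C \<rho>(1) by (intro power_mono) auto
    qed (use \<open>M \<ge> 0\<close> \<rho>(1) in auto)
    also have "\<dots> = c * (2 powr b * ?q) ^ l k"
      unfolding c_def by (simp add: power_mult_distrib algebra_simps)
    \<comment> \<open>Because \<open>b - t / 2 = - 2 * d\<close>, one factor cancels against the
      lower bound for the weight and the other is left as decay.\<close>
    also have "2 powr b * ?q = 2 powr (- d) * 2 powr (- d)"
      unfolding powr_add[symmetric] d_def by (rule arg_cong[where f = "(powr) 2"]) (simp add: field_simps)
    finally have "(2 powr (- d)) ^ l k * measure \<mu> U \<le> (2 powr (- d)) ^ l k * (c * (2 powr (- d)) ^ l k)"
      by (simp only: power_mult_distrib mult_ac)
    then show ?thesis by (rule mult_left_le_imp_le) simp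
  qed
  have lim: "filterlim l sequentially sequentially" by (rule strict_mono_on_filterlim[OF l])
  have "(\<lambda>L. real L / 2 ^ L) \<longlonglongrightarrow> 0" using lim_n_over_pown[of "2::real"] by simp
  then have "eventually (\<lambda>L. real L / 2 ^ L < 1 / (real C + 1)) sequentially"
    by (rule order_tendstoD) simp
  then have "eventually (\<lambda>L. real C * real L \<le> 2 ^ L) sequentially"
  proof eventually_elim
    case (elim L)
    then have "real L * (real C + 1) < 2 ^ L" by (simp add: divide_simps)
    then show ?case by (simp add: algebra_simps)
  qed
  then have "eventually (\<lambda>k. real C * real (l k) \<le> 2 ^ l k) sequentially"
    using lim by (rule eventually_compose_filterlim)
  then have "eventually (\<lambda>k. measure \<mu> U \<le> c * (2 powr (- d)) ^ l k) sequentially"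
    using eventually_ge_at_top[of n0] by eventually_elim (rule bound)
  moreover have "(\<lambda>k. c * (2 powr (- d)) ^ l k) \<longlonglongrightarrow> c * 0"
  proof (intro tendsto_mult_left filterlim_compose[OF _ lim])
    show "(\<lambda>L. (2 powr (- d)) ^ L) \<longlonglongrightarrow> 0" using \<open>d > 0\<close> by (intro LIMSEQ_realpow_zero) (auto simp: powr_less_one)
  qed
  ultimately have "measure \<mu> U \<le> c * 0" by (intro tendsto_lowerbound[where F = sequentially]) auto
  then show False using U_pos by simp
qed

section \<open>Dimensions of the sets\<close>

lemma hausdorff_content_le_double_sum:
  fixes U :: "nat \<times> nat \<Rightarrow> 'a::metric_space set"
  assumes "\<And>p. bounded (U p)" "\<And>p. diameter (U p) \<le> \<delta>" "A \<subseteq> (\<Union>p. U p)"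
  shows "hausdorff_content s \<delta> A \<le> (\<Sum>i. \<Sum>j. diam_power s (U (i, j)))"
proof -
  have "(\<Union>p. U p) = (\<Union>i. U (prod_decode i))"
    using surj_prod_decode by (metis image_image)
  then have "hausdorff_content s \<delta> A \<le> (\<Sum>i. diam_power s (U (prod_decode i)))"
    unfolding hausdorff_content_def using assms by (intro INF_lower) auto
  also have "\<dots> = (\<Sum>i. \<Sum>j. diam_power s (U (i, j)))"
    by (rule suminf_ennreal_2dimen) simp
  finally show ?thesis .
qed

text \<open>Every point of \<open>C\<close> lies in a gap of some index \<open>k > N\<close>. The
  gaps of index \<open>k\<close> are covered by \<open>2 ^ l k\<close> intervals of length
  \<open>2 powr (- (l k + m k))\<close>, whose total is at most \<open>q ^ l k\<close>; summing over
  \<open>k\<close> gives a geometric tail.\<close>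

lemma hausdorff_content_C_set_le:
  fixes b s \<delta> :: real and l :: "nat \<Rightarrow> nat"
  defines "q \<equiv> 2 powr (1 - s * (1 + b))"
  assumes "b > 0" "s > 0" "s * (1 + b) > 1" and l: "strict_mono_on {1..} l"
    and N: "N \<ge> 1" "1 / 2 ^ N \<le> \<delta>"
  shows "hausdorff_content s \<delta> (C_set b l) \<le> ennreal (q ^ N / (1 - q))"
proof -
  let ?k = "\<lambda>i. Suc (N + i)"
  let ?L = "\<lambda>i. l (?k i)" and ?m = "\<lambda>i. m_seq b l (?k i)"
  define I where "I i j = {real j / 2 ^ ?L i .. real j / 2 ^ ?L i + 1 / 2 ^ (?L i + ?m i)}" for i j
  \<comment> \<open>Left endpoints of the intervals lie in \<open>[0, 1)\<close>; the remaining
    indices are padded with empty sets, which contribute 0.\<close>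
  define U where "U = (\<lambda>(i, j). if j < 2 ^ ?L i then I i j else {})"
  have L: "N + i \<le> ?L i" for i using strict_mono_on_ge_pred[OF l, of "N + i"] .
  have m1: "?m i \<ge> 1" for i
  proof -
    have "0 < b * real (?L i)" using L[of i] N(1) \<open>b > 0\<close> by simp
    then show ?thesis using m_seq_ge[of b l "?k i"] by linarith
  qed
  have diam: "diameter (I i j) = 1 / 2 ^ (?L i + ?m i)" for i j
    unfolding I_def by simp
  have "hausdorff_content s \<delta> (C_set b l) \<le> (\<Sum>i. \<Sum>j. diam_power s (U (i, j)))"
  proof (rule hausdorff_content_le_double_sum)
    fix p :: "nat \<times> nat"
    obtain i j where p: "p = (i, j)" by fastforce
    show "bounded (U p)" by (simp add: p U_def I_def)
    have "0 \<le> \<delta>" using N(2) by (meson order_trans zero_le_divide_1_iff zero_le_numeral zero_le_power)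
    moreover have "1 / 2 ^ (?L i + ?m i) \<le> 1 / (2::real) ^ N"
      using L[of i] by (intro divide_left_mono power_increasing) auto
    ultimately show "diameter (U p) \<le> \<delta>" using N(2) diam by (simp add: p U_def)
  next
    show "C_set b l \<subseteq> (\<Union>p. U p)"
    proof
      fix x assume "x \<in> C_set b l"
      then have "x \<in> (\<Union>k\<in>{Suc N..}. {0..1} - A_set b l k)" unfolding C_set_eq by auto
      then obtain k where "k \<ge> Suc N" and gap: "x \<in> {0..1} - A_set b l k" by blast
      then obtain i where k: "k = ?k i" by (metis add_Suc le_Suc_ex)
      define j where "j = nat \<lfloor>2 ^ ?L i * x\<rfloor>"
      have x: "0 \<le> x" "x < 1" "frac (2 ^ ?L i * x) < 1 / 2 ^ ?m i"
        using gap frac_less_off_A_set[OF gap] m1 by (auto simp: k)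
      have j: "real j = of_int \<lfloor>2 ^ ?L i * x\<rfloor>" unfolding j_def using x(1) by simp
      have "2 ^ ?L i * x < 2 ^ ?L i" using x(2) by simp
      then have "real j < 2 ^ ?L i" unfolding j by linarith
      then have "j < 2 ^ ?L i" by simp
      moreover have "real j / 2 ^ ?L i + frac (2 ^ ?L i * x) / 2 ^ ?L i \<in> I i j"
        using x(3) unfolding I_def by (simp add: power_add field_simps)
      moreover have "x = real j / 2 ^ ?L i + frac (2 ^ ?L i * x) / 2 ^ ?L i"
        unfolding j frac_def by (simp add: field_simps)
      ultimately have "x \<in> U (i, j)" unfolding U_def by simp
      then show "x \<in> (\<Union>p. U p)" by blast
    qed
  qed
  also have "\<dots> \<le> (\<Sum>i. ennreal (q ^ N * q ^ i))"
  proof (intro suminf_le summableI)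
    fix i
    let ?d = "(1 / 2 ^ (?L i + ?m i)) powr s :: real"
    have "(\<Sum>j. diam_power s (U (i, j))) = (\<Sum>j<2 ^ ?L i. diam_power s (U (i, j)))"
      by (rule suminf_finite) (auto simp: U_def diam_power_def)
    also have "\<dots> = (\<Sum>j<(2::nat) ^ ?L i. ennreal ?d)"
    proof (rule sum.cong)
      fix j :: nat assume "j \<in> {..<2 ^ ?L i}"
      moreover have "I i j \<noteq> {}" unfolding I_def by simp
      ultimately show "diam_power s (U (i, j)) = ennreal ?d"
        using \<open>s > 0\<close> by (simp add: U_def diam_power_def diam)
    qed simp
    also have "\<dots> = ennreal (2 ^ ?L i * ?d)"
      by (simp add: ennreal_mult ennreal_power[symmetric])
    also have "2 ^ ?L i * ?d \<le> q ^ N * q ^ i"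
    proof -
      have "1 / 2 ^ (?L i + ?m i) = 2 powr (- real (?L i + ?m i))"
        by (simp add: powr_minus powr_realpow divide_inverse del: of_nat_add)
      then have "2 ^ ?L i * ?d = 2 powr (real (?L i) - s * (real (?L i) + real (?m i)))"
        by (simp add: powr_powr powr_realpow[symmetric] powr_add[symmetric] algebra_simps)
      also have "\<dots> \<le> 2 powr ((1 - s * (1 + b)) * real (N + i))"
      proof (rule powr_mono)
        have "s * (b * real (?L i)) \<le> s * real (?m i)"
          using \<open>s > 0\<close> m_seq_ge by (intro mult_left_mono) auto
        then have "real (?L i) - s * (real (?L i) + real (?m i)) \<le> (1 - s * (1 + b)) * real (?L i)"
          by (simp add: algebra_simps)
        \<comment> \<open>The coefficient \<open>1 - s * (1 + b)\<close> is negative, so the lower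
          bound for \<open>l\<close> becomes an upper bound.\<close>
        also have "\<dots> \<le> (1 - s * (1 + b)) * real (N + i)"
          using L[of i] \<open>s * (1 + b) > 1\<close> by (intro mult_left_mono_neg) auto
        finally show "real (?L i) - s * (real (?L i) + real (?m i)) \<le> (1 - s * (1 + b)) * real (N + i)" .
      qed simp
      also have "\<dots> = q ^ (N + i)"
        unfolding q_def by (simp only: powr_powr[symmetric]) (rule powr_realpow, simp)
      finally show ?thesis by (simp only: power_add)
    qed
    finally show "(\<Sum>j. diam_power s (U (i, j))) \<le> ennreal (q ^ N * q ^ i)"
      by (simp add: ennreal_leI)
  qed
  also have "\<dots> = ennreal (q ^ N * (1 / (1 - q)))"
  proof (rule suminf_ennreal_eq)
    have "q < 1" "0 < q" using \<open>s * (1 + b) > 1\<close> unfolding q_def by (auto simp: powr_less_one)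
    then show "(\<lambda>i. q ^ N * q ^ i) sums (q ^ N * (1 / (1 - q)))"
      by (intro sums_mult geometric_sums) simp
    show "0 \<le> q ^ N * q ^ i" for i using \<open>0 < q\<close> by simp
  qed
  finally show ?thesis by simp
qed

lemma hausdorff_content_C_set:
  assumes "b > 0" "s > 0" "s * (1 + b) > 1" and l: "strict_mono_on {1..} l" and "\<delta> > 0"
  shows "hausdorff_content s \<delta> (C_set b l) = 0"
proof -
  define q where "q = 2 powr (1 - s * (1 + b))"
  have q: "0 < q" "q < 1" using \<open>s * (1 + b) > 1\<close> unfolding q_def by (auto simp: powr_less_one)
  have "(\<lambda>N. (1 / 2 :: real) ^ N) \<longlonglongrightarrow> 0" by (rule LIMSEQ_realpow_zero) auto
  then have "eventually (\<lambda>N. (1 / 2) ^ N < \<delta>) sequentially"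
    using \<open>\<delta> > 0\<close> by (rule order_tendstoD)
  then have "eventually (\<lambda>N. hausdorff_content s \<delta> (C_set b l) \<le> ennreal (q ^ N / (1 - q))) sequentially"
    using eventually_ge_at_top[of 1]
  proof eventually_elim
    case (elim N)
    then show ?case unfolding q_def
      by (intro hausdorff_content_C_set_le assms) (auto simp: power_one_over)
  qed
  moreover have "(\<lambda>N. ennreal (q ^ N / (1 - q))) \<longlonglongrightarrow> ennreal (0 / (1 - q))"
    using q by (intro tendsto_ennrealI tendsto_divide LIMSEQ_realpow_zero tendsto_const) auto
  ultimately have "hausdorff_content s \<delta> (C_set b l) \<le> ennreal (0 / (1 - q))"
    by (intro tendsto_lowerbound[where F = sequentially]) auto
  then show ?thesis by simp
qed

section \<open>The compact Fourier dimension of the unit interval\<close>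

lemma fourier_transform_unit_interval:
  fixes \<xi> :: real
  assumes "\<xi> \<noteq> 0"
  shows "norm (fourier_transform (density lborel (indicator {0..1})) \<xi>) \<le> \<bar>\<xi>\<bar> powr (- 1 / 2)"
proof -
  let ?\<mu> = "density lborel (indicator {0..1::real})"
  let ?c = "- 2 * complex_of_real pi * \<i> * complex_of_real \<xi>"
  let ?f = "\<lambda>x. exp (?c * complex_of_real x)"
  have "?c \<noteq> 0" using assms by simp
  have "fourier_transform ?\<mu> \<xi> = (LINT x|density lborel (\<lambda>x. ennreal (indicator {0..1} x)). ?f x)"
    unfolding fourier_transform_def by (simp add: ennreal_indicator mult.assoc)
  also have "\<dots> = (LINT x|lborel. indicator {0..1} x *\<^sub>R ?f x)"
    by (rule integral_density) (auto intro!: borel_measurable_continuous_onI continuous_intros)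
  finally have ft: "fourier_transform ?\<mu> \<xi> = (LINT x|lborel. indicator {0..1} x *\<^sub>R ?f x)" .
  have norm_f: "norm (?f x) = 1" for x by simp
  have "(LINT x|lborel. indicator {0..1} x *\<^sub>R ?f x) = ?f 1 / ?c - ?f 0 / ?c"
  proof (rule integral_FTC_atLeastAtMost)
    show "((\<lambda>x. ?f x / ?c) has_vector_derivative ?f x) (at x within {0..1})" for x
      using \<open>?c \<noteq> 0\<close>
      by (auto intro!: derivative_eq_intros has_vector_derivative_real_field simp del: mult_minus_left)
    show "continuous_on {0..1} ?f" by (intro continuous_intros)
  qed simp
  then have "norm (fourier_transform ?\<mu> \<xi>) \<le> norm (?f 1 / ?c) + norm (?f 0 / ?c)"
    unfolding ft by (simp only: norm_triangle_ineq4)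
  also have "\<dots> = 1 / (pi * \<bar>\<xi>\<bar>)"
    unfolding norm_divide norm_f by (simp add: norm_mult)
  finally have large: "norm (fourier_transform ?\<mu> \<xi>) \<le> 1 / (pi * \<bar>\<xi>\<bar>)" .
  have "norm (fourier_transform ?\<mu> \<xi>) \<le> (LINT x|lborel. norm (indicator {0..1::real} x *\<^sub>R ?f x))"
    unfolding ft by (rule integral_norm_bound)
  also have "\<dots> = (LINT x|lborel. indicator {0..1::real} x)"
    unfolding norm_scaleR norm_f by simp
  also have "\<dots> = 1" by simp
  finally have small: "norm (fourier_transform ?\<mu> \<xi>) \<le> 1" .
  show ?thesis
  proof (cases "\<bar>\<xi>\<bar> \<le> 1")
    case True
    then have "1 powr (- 1 / 2) \<le> \<bar>\<xi>\<bar> powr (- 1 / 2)" using assms by (intro powr_mono2') auto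
    then show ?thesis using small by simp
  next
    case False
    have "1 / (pi * \<bar>\<xi>\<bar>) \<le> 1 / \<bar>\<xi>\<bar>"
      using pi_ge_two assms by (intro divide_left_mono) (auto simp: mult_le_cancel_right1)
    also have "\<dots> = \<bar>\<xi>\<bar> powr (- 1)" using assms by (simp add: powr_minus divide_inverse)
    also have "\<dots> \<le> \<bar>\<xi>\<bar> powr (- 1 / 2)" using False by (intro powr_mono) auto
    finally show ?thesis using large by simp
  qed
qed

lemma compact_fourier_dim_unit_interval: "compact_fourier_dim {0..1::real} \<ge> 1"
proof -
  let ?\<mu> = "density lborel (indicator {0..1::real})"
  have em: "emeasure ?\<mu> A = emeasure lborel ({0..1} \<inter> A)" if "A \<in> sets borel" for A
    using that by (subst emeasure_density) (auto simp: indicator_inter_arith[symmetric])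
  have "prob_space ?\<mu>" by (rule prob_spaceI) (simp add: em)
  then have "?\<mu> \<in> borel_probs {0..1}" unfolding borel_probs_def by (simp add: em)
  moreover have "fourier_decay ?\<mu> 1"
    unfolding fourier_decay_def using fourier_transform_unit_interval by (intro exI[of _ 1]) simp
  ultimately have "ennreal 1 \<le> compact_fourier_dim {0..1::real}"
    unfolding compact_fourier_dim_def by (intro SUP_upper) (auto intro!: exI[of _ "{0..1::real}"])
  then show ?thesis by simp
qed

section \<open>Dimension bounds and failure of finite stability\<close>

lemma fourier_dim_le_compact_fourier_dim:
  "compact K \<Longrightarrow> K \<subseteq> A \<Longrightarrow> fourier_dim K \<le> compact_fourier_dim A"
  unfolding fourier_dim_def compact_fourier_dim_def by (intro SUP_subset_mono) auto

lemma compact_fourier_dim_Union_B_set: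
  fixes b :: real and l :: "nat \<Rightarrow> nat"
  assumes "b > 0" "strict_mono_on {1..} l" "2 * b \<le> s"
  shows "compact_fourier_dim (\<Union>n\<in>{1..}. B_set b l n) \<le> ennreal s"
  unfolding compact_fourier_dim_def
proof (rule SUP_least)
  fix t assume "t \<in> {t \<in> {0..real DIM(real)}. \<exists>K. compact K \<and> K \<subseteq> (\<Union>n\<in>{1..}. B_set b l n) \<and>
      (\<exists>\<mu>\<in>borel_probs K. fourier_decay \<mu> t)}"
  then obtain K \<mu> where "compact K" "K \<subseteq> (\<Union>n\<in>{1..}. B_set b l n)" "prob_space \<mu>"
      "sets \<mu> = sets borel" "emeasure \<mu> K = 1" "fourier_decay \<mu> t"
    unfolding borel_probs_def by blast
  then have "\<not> 2 * b < t" using no_decay_on_Union_B_set[OF assms(1,2)] by blast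
  then show "ennreal t \<le> ennreal s" using assms(3) by (intro ennreal_leI) simp
qed

text \<open>
  Replaces the general inequality between Fourier and Hausdorff dimension.
\<close>

lemma compact_fourier_dim_C_set:
  fixes b :: real and l :: "nat \<Rightarrow> nat"
  assumes "b > 0" "strict_mono_on {1..} l"
  shows "compact_fourier_dim (C_set b l) = 0"
proof -
  have "compact_fourier_dim (C_set b l) \<le> 0"
    unfolding compact_fourier_dim_def
  proof (rule SUP_least)
    fix t assume "t \<in> {t \<in> {0..real DIM(real)}. \<exists>K. compact K \<and> K \<subseteq> C_set b l \<and>
      (\<exists>\<mu>\<in>borel_probs K. fourier_decay \<mu> t)}"
    then obtain K \<mu> where K: "compact K" "K \<subseteq> C_set b l" and \<mu>: "prob_space \<mu>"
      "sets \<mu> = sets borel" "emeasure \<mu> K = 1" "fourier_decay \<mu> t"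
      unfolding borel_probs_def by blast
    interpret prob_space \<mu> by fact
    have "\<not> t > 0"
    proof
      assume "t > 0"
      have "AE x in \<mu>. x \<in> K"
        using K(1) \<mu>(2,3) by (subst prob_eq_1[symmetric]) (auto simp: compact_imp_closed emeasure_eq_measure)
      moreover have "AE x in \<mu>. x \<notin> C_set b l"
        using C_set_null[OF assms \<mu>(1,2,4) \<open>t > 0\<close>] .
      ultimately have "AE x in \<mu>. False" by eventually_elim (use K(2) in blast)
      then show False by simp
    qed
    then show "ennreal t \<le> 0" by (simp add: ennreal_neg)
  qed
  then show ?thesis by simp
qed

lemma C_set_hausdorff_dim_le:
  assumes "b > 0" "s > 0" "s * (1 + b) > 1" and "strict_mono_on {1..} l"
  shows "hausdorff_dim (C_set b l) \<le> ennreal s"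
proof -
  have "hausdorff_measure s (C_set b l) = 0"
    unfolding hausdorff_measure_def using hausdorff_content_C_set[OF assms]
    by (auto simp: SUP_eq_const)
  then show ?thesis unfolding hausdorff_dim_def using assms(2) by (intro INF_lower) simp
qed

lemma unit_interval_eq_Union_B_set_C_set:
  fixes b :: real and l :: "nat \<Rightarrow> nat"
  shows "{0..1} = (\<Union>n\<in>{1..}. B_set b l n) \<union> C_set b l"
  using B_set_subset unfolding C_set_def by blast

text \<open>The union of the \<open>B\<^sub>n\<close> has dimension at most \<open>2 * b < 1\<close>
  and \<open>C\<close> has dimension 0, but together they form \<open>{0..1}\<close>, of dimension
  at least 1.\<close>

lemma not_finitely_stable_compact_fourier_dim:
  fixes b :: real and l :: "nat \<Rightarrow> nat"
  assumes "b > 0" "strict_mono_on {1..} l" "2 * b < 1"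
  shows "\<not> finitely_stable (compact_fourier_dim :: real set \<Rightarrow> ennreal)"
proof
  assume stable: "finitely_stable (compact_fourier_dim :: real set \<Rightarrow> ennreal)"
  let ?B = "\<Union>n\<in>{1..}. B_set b l n"
  let ?A = "\<lambda>k::nat. if k = 1 then ?B else C_set b l"
  have "?B \<in> sets borel"
    using compact_B_set by (intro sets.countable_UN') (auto intro: borel_compact)
  then have "\<forall>k\<in>{1..2}. ?A k \<in> sets borel" unfolding C_set_def by auto
  with one_le_numeral have "compact_fourier_dim (\<Union>k\<in>{1..2}. ?A k) = (SUP k\<in>{1..2}. compact_fourier_dim (?A k))"
    by (intro stable[unfolded finitely_stable_def, rule_format] conjI) blast+
  moreover have two: "{1..2} = {1, 2::nat}" by auto
  ultimately have "compact_fourier_dim {0..1::real} = sup (compact_fourier_dim ?B) (compact_fourier_dim (C_set b l))"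
    unfolding unit_interval_eq_Union_B_set_C_set[of b l] two by (simp add: Un_commute)
  also have "\<dots> \<le> ennreal (2 * b)"
    using compact_fourier_dim_Union_B_set[OF assms(1,2) order_refl] compact_fourier_dim_C_set[OF assms(1,2)] by simp
  also have "\<dots> < 1" using assms by (simp add: ennreal_less_one_iff)
  finally show False using compact_fourier_dim_unit_interval by simp
qed

theorem mainTheorem8:
  fixes s :: real
  assumes "sqrt 3 - 1 < s" and "s < 1"
  shows "(\<exists>b::real. (1 - s) / s < b \<and> b < s / 2) \<and>
    (\<forall>(b::real) (l :: nat \<Rightarrow> nat).
       (1 - s) / s < b \<and> b < s / 2 \<and> strict_mono_on {1..} l \<longrightarrow>
         (\<forall>k\<ge>1. compact (A_set b l k)) \<and>
         C_set b l = (\<Inter>n\<in>{1..}. \<Union>k\<in>{n..}. {0..1} - A_set b l k) \<and>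
         (\<forall>n\<ge>1. fourier_dim (B_set b l n) \<le> ennreal s) \<and>
         compact_fourier_dim (\<Union>n\<in>{1..}. B_set b l n) \<le> ennreal s \<and>
         (\<forall>\<delta>>0. hausdorff_content s \<delta> (C_set b l) = 0) \<and>
         compact_fourier_dim (C_set b l) \<le> hausdorff_dim (C_set b l) \<and>
         hausdorff_dim (C_set b l) \<le> ennreal s \<and>
         {0..1} = (\<Union>n\<in>{1..}. B_set b l n) \<union> C_set b l \<and>
         compact_fourier_dim (\<Union>n\<in>{1..}. B_set b l n) < 1 \<and>
         compact_fourier_dim (C_set b l) < 1) \<and>
    \<not> finitely_stable (compact_fourier_dim :: real set \<Rightarrow> ennreal)"
proof -
  have "1 < sqrt 3" by (rule real_less_rsqrt) simp
  then have "s > 0" using assms(1) by linarith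
  \<comment> \<open>The inequality \<open>3 < (s + 1)\<^sup>2\<close> rearranges to
    \<open>2 * (1 - s) < s\<^sup>2\<close>, which leaves room for \<open>b\<close>.\<close>
  have "(sqrt 3)\<^sup>2 < (s + 1)\<^sup>2" using assms(1) by (intro power_strict_mono) auto
  then have "(1 - s) / s < s / 2" using \<open>s > 0\<close> by (simp add: divide_simps power2_eq_square algebra_simps)
  then obtain b0 where b0: "(1 - s) / s < b0" "b0 < s / 2" using dense by blast
  have pos: "b > 0" "s * (1 + b) > 1" if "(1 - s) / s < b" for b :: real
  proof -
    have "0 < (1 - s) / s" using \<open>s > 0\<close> assms(2) by simp
    then show "b > 0" using that by linarith
    show "s * (1 + b) > 1" using that \<open>s > 0\<close> by (simp add: divide_less_eq algebra_simps)
  qed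
  have s1: "ennreal s < 1" using assms(2) \<open>s > 0\<close> by (simp add: ennreal_less_one_iff)
  have unstable: "\<not> finitely_stable (compact_fourier_dim :: real set \<Rightarrow> ennreal)"
    using not_finitely_stable_compact_fourier_dim[of b0 "\<lambda>k. k"] pos[OF b0(1)] b0(2) assms(2)
    by (auto simp: strict_mono_on_def)
  have main: "(\<forall>k\<ge>1. compact (A_set b l k)) \<and>
         C_set b l = (\<Inter>n\<in>{1..}. \<Union>k\<in>{n..}. {0..1} - A_set b l k) \<and>
         (\<forall>n\<ge>1. fourier_dim (B_set b l n) \<le> ennreal s) \<and>
         compact_fourier_dim (\<Union>n\<in>{1..}. B_set b l n) \<le> ennreal s \<and>
         (\<forall>\<delta>>0. hausdorff_content s \<delta> (C_set b l) = 0) \<and>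
         compact_fourier_dim (C_set b l) \<le> hausdorff_dim (C_set b l) \<and>
         hausdorff_dim (C_set b l) \<le> ennreal s \<and>
         {0..1} = (\<Union>n\<in>{1..}. B_set b l n) \<union> C_set b l \<and>
         compact_fourier_dim (\<Union>n\<in>{1..}. B_set b l n) < 1 \<and>
         compact_fourier_dim (C_set b l) < 1"
    if b: "(1 - s) / s < b" "b < s / 2" and l: "strict_mono_on {1..} l" for b :: real and l :: "nat \<Rightarrow> nat"
  proof (intro conjI allI impI)
    have UB: "compact_fourier_dim (\<Union>n\<in>{1..}. B_set b l n) \<le> ennreal s"
      using b(2) by (intro compact_fourier_dim_Union_B_set pos b l) simp
    show "compact_fourier_dim (\<Union>n\<in>{1..}. B_set b l n) \<le> ennreal s" by (fact UB)
    show "compact_fourier_dim (\<Union>n\<in>{1..}. B_set b l n) < 1" using UB s1 by (rule le_less_trans)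
    \<comment> \<open>Each \<open>B\<^sub>n\<close> is compact, hence itself an admissible
      \<open>K\<close> for the union, and inherits the bound from there.\<close>
    show "fourier_dim (B_set b l n) \<le> ennreal s" if "n \<ge> 1" for n
      using that by (intro order_trans[OF fourier_dim_le_compact_fourier_dim UB] compact_B_set) auto
    show "hausdorff_content s \<delta> (C_set b l) = 0" if "\<delta> > 0" for \<delta>
      using pos b \<open>s > 0\<close> l that by (intro hausdorff_content_C_set)
    show "hausdorff_dim (C_set b l) \<le> ennreal s"
      using pos b \<open>s > 0\<close> l by (intro C_set_hausdorff_dim_le)
    have C: "compact_fourier_dim (C_set b l) = 0"
      using pos b l by (intro compact_fourier_dim_C_set)
    show "compact_fourier_dim (C_set b l) \<le> hausdorff_dim (C_set b l)" "compact_fourier_dim (C_set b l) < 1"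
      unfolding C by simp_all
  qed (rule compact_A_set C_set_eq unit_interval_eq_Union_B_set_C_set)+
  show ?thesis
    by (rule conjI[OF exI conjI], rule conjI[OF b0], intro allI impI, elim conjE, rule main, assumption+, rule unstable)
qed

end
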